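(* Let $J\subset\mathbb{R}$ be a bounded open interval. Every (in general complex-valued) distribution $q\in W^{-1,2}(J)$ is admissible; that is, there exists $f\in\mathscr{D}_2(\mathbf{S}_q)$ with $\mathbf{S}_q f=0$ and $f(x)\neq 0$ for all $x\in\overline{J}$.
   Context: All functions are complex-valued. $W^{1,2}(J)$ is the usual Sobolev space (its elements are identified with their continuous representatives on $\overline{J}$), $W_0^{1,2}(J)$ is the closure of $C_0^\infty(J)$ in it, $W^{-1,2}(J)$ is the topological dual of $W^{1,2}_0(J)$, and $(q|\phi)$ denotes the action of $q\in W^{-1,2}(J)$ on $\phi\in W_0^{1,2}(J)$ (linear in both arguments). For $q\in W^{-1,2}(J)$ and $y\in W^{1,2}(J)$ the distribution $\mathbf{S}_q y=-y''+qy\in W^{-1,2}(J)$ is defined by $(\mathbf{S}_q y|\phi)=\int_J y'\phi'\,dx+(q|y\phi)$ for $\phi\in W_0^{1,2}(J)$. A distribution $T$ is $L^2$-regular if there is $g\in L^2(J)$ with $(T|\phi)=\int_J g\phi\,dx$ for all $\phi$. $\mathscr{D}_2(\mathbf{S}_q):=\{y\in W^{1,2}(J): \mathbf{S}_q y\text{ is } L^2\text{-regular}\}$. The potential $q$ is called admissible if there exists $f\in\mathscr{D}_2(\mathbf{S}_q)$ with $\mathbf{S}_qf=0$ and $f(x)\ne0$ for all $x\in\overline J$. *)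

theory Defs
  imports "HOL-Analysis.Analysis"
begin

definition test_function :: "real set \<Rightarrow> (real \<Rightarrow> complex) \<Rightarrow> bool" where
  "test_function J \<phi> \<longleftrightarrow>
     (\<exists>D. D 0 = \<phi> \<and> (\<forall>n x. (D n has_vector_derivative D (Suc n) x) (at x))) \<and>
     compact (closure {x. \<phi> x \<noteq> 0}) \<and> closure {x. \<phi> x \<noteq> 0} \<subseteq> J"

definition square_integrable_on :: "(real \<Rightarrow> complex) \<Rightarrow> real set \<Rightarrow> bool" where
  "square_integrable_on g J \<longleftrightarrow>
     set_borel_measurable lebesgue J g \<and> set_integrable lebesgue J (\<lambda>x. (cmod (g x))\<^sup>2)"

definition has_weak_derivative_on ::
    "(real \<Rightarrow> complex) \<Rightarrow> (real \<Rightarrow> complex) \<Rightarrow> real set \<Rightarrow> bool" where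
  "has_weak_derivative_on y g J \<longleftrightarrow>
     (\<forall>\<phi>. test_function J \<phi> \<longrightarrow>
        (LINT x:J|lebesgue. y x * vector_derivative \<phi> (at x)) = - (LINT x:J|lebesgue. g x * \<phi> x))"

(* Continuity on the closure selects the continuous representative. Values outside the closure
   of J are unconstrained; they are ignored by every notion below. *)
definition W12 :: "real set \<Rightarrow> (real \<Rightarrow> complex) set" where
  "W12 J = {y. square_integrable_on y J \<and> continuous_on (closure J) y \<and>
     (\<exists>g. square_integrable_on g J \<and> has_weak_derivative_on y g J)}"

(* A choice among a.e.-equal functions; it is used only under integrals over J. *)
definition weak_deriv :: "real set \<Rightarrow> (real \<Rightarrow> complex) \<Rightarrow> real \<Rightarrow> complex" where
  "weak_deriv J y = (SOME g. square_integrable_on g J \<and> has_weak_derivative_on y g J)"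

definition W12_norm :: "real set \<Rightarrow> (real \<Rightarrow> complex) \<Rightarrow> real" where
  "W12_norm J y = sqrt ((LINT x:J|lebesgue. (cmod (y x))\<^sup>2) +
                        (LINT x:J|lebesgue. (cmod (weak_deriv J y x))\<^sup>2))"

definition W12_0 :: "real set \<Rightarrow> (real \<Rightarrow> complex) set" where
  "W12_0 J = {y \<in> W12 J. \<forall>\<epsilon>>0. \<exists>\<phi>. test_function J \<phi> \<and> W12_norm J (\<lambda>x. y x - \<phi> x) < \<epsilon>}"

(* Only the values of q on W12_0 J matter. Boundedness forces q to agree on functions in W12_0 J
   that coincide on J, so q is well defined on the Sobolev space itself. *)
definition W_minus12 :: "real set \<Rightarrow> ((real \<Rightarrow> complex) \<Rightarrow> complex) set" where
  "W_minus12 J = {q.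
     (\<forall>\<phi>\<in>W12_0 J. \<forall>\<psi>\<in>W12_0 J. q (\<lambda>x. \<phi> x + \<psi> x) = q \<phi> + q \<psi>) \<and>
     (\<forall>c. \<forall>\<phi>\<in>W12_0 J. q (\<lambda>x. c * \<phi> x) = c * q \<phi>) \<and>
     (\<exists>C. \<forall>\<phi>\<in>W12_0 J. cmod (q \<phi>) \<le> C * W12_norm J \<phi>)}"

definition schroedinger ::
    "real set \<Rightarrow> ((real \<Rightarrow> complex) \<Rightarrow> complex) \<Rightarrow> (real \<Rightarrow> complex) \<Rightarrow> (real \<Rightarrow> complex) \<Rightarrow> complex" where
  "schroedinger J q y \<phi> =
     (LINT x:J|lebesgue. weak_deriv J y x * weak_deriv J \<phi> x) + q (\<lambda>x. y x * \<phi> x)"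

definition L2_regular :: "real set \<Rightarrow> ((real \<Rightarrow> complex) \<Rightarrow> complex) \<Rightarrow> bool" where
  "L2_regular J T \<longleftrightarrow>
     (\<exists>g. square_integrable_on g J \<and> (\<forall>\<phi>\<in>W12_0 J. T \<phi> = (LINT x:J|lebesgue. g x * \<phi> x)))"

definition schroedinger_domain ::
    "real set \<Rightarrow> ((real \<Rightarrow> complex) \<Rightarrow> complex) \<Rightarrow> (real \<Rightarrow> complex) set" where
  "schroedinger_domain J q = {y \<in> W12 J. L2_regular J (schroedinger J q y)}"

definition admissible :: "real set \<Rightarrow> ((real \<Rightarrow> complex) \<Rightarrow> complex) \<Rightarrow> bool" where
  "admissible J q \<longleftrightarrow>
     (\<exists>f\<in>schroedinger_domain J q.
        (\<forall>\<phi>\<in>W12_0 J. schroedinger J q f \<phi> = 0) \<and> (\<forall>x\<in>closure J. f x \<noteq> 0))"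

end

theory Submission
  imports Defs
begin

text \<open>
  By the Riesz representation theorem \<open>q = Q'\<close> for some \<open>Q\<close> in \<open>L\<^sup>2\<close>, and \<open>- y'' + q y = 0\<close> becomes
  the first order system \<open>y' = Q y + u\<close>, \<open>u' = - Q u - Q\<^sup>2 y\<close>. With \<open>P' = Q\<close>, \<open>y = exp P z\<close> and
  \<open>u = exp (- P) v\<close> it turns into \<open>z' = exp (- 2 P) v\<close>, \<open>v' = - Q\<^sup>2 exp (2 P) z\<close>, whose coefficients
  are integrable and whose solutions \<open>z\<close> are continuously differentiable. Two solutions with
  Wronskian 1 have no common zero, and \<open>z1 + c z2\<close> vanishes somewhere only if \<open>c\<close> lies on the curve
  \<open>- z1 / z2\<close>, which is a null set of the complex plane.
\<close>

section \<open>Absolutely continuous functions\<close>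

text \<open>Writing \<open>u\<close> for the quasi-derivative \<open>y' - Q y\<close> hides the
  distribution: \<open>Q' y = (Q y)' - Q y'\<close> turns the equation into
  \<open>u' = - Q y'\<close>, in which \<open>Q\<close> is multiplied but never differentiated. The
  coefficients are still mere integrable functions, so nothing holds pointwise; all calculus is
  therefore done with primitives of integrable functions, for which product and exponential rules
  are proved as identities of integrals. The factor \<open>exp P\<close> removes \<open>Q\<close>
  from the diagonal: the equation for \<open>z\<close> then has the continuous coefficient
  \<open>exp (- 2 P)\<close>, so \<open>z\<close> is differentiable everywhere and the null set
  theorem for differentiable images applies. Complex combinations are essential: every real solution
  of \<open>y'' = - y\<close> has a zero on a long interval, while \<open>exp (i x)\<close> has
  none. The other obstacle is that \<open>q\<close> is known only as a functional on a closure of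
  test functions. To obtain \<open>Q\<close>, and to evaluate \<open>q\<close> on
  \<open>f \<phi>\<close>, that closure must be identified with the primitives of square-integrable
  functions that vanish at both ends, which is proved in both directions.\<close>

lemma absolutely_integrable_on_Icc_mult_continuous:
  fixes g f :: "real \<Rightarrow> complex"
  assumes "g absolutely_integrable_on {a..b}" "continuous_on {a..b} f"
  shows "(\<lambda>x. f x * g x) absolutely_integrable_on {a..b}"
proof (rule absolutely_integrable_bounded_measurable_product[of "(*)"])
  show "bilinear ((*) :: complex \<Rightarrow> _)"
    by (simp add: bilinear_conv_bounded_bilinear bounded_bilinear_mult)
  show "f \<in> borel_measurable (lebesgue_on {a..b})"
    using assms(2) by (intro continuous_imp_measurable_on_sets_lebesgue) auto
  show "bounded (f ` {a..b})"
    using assms(2) by (intro compact_imp_bounded compact_continuous_image) auto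
qed (use assms in auto)

text \<open>Fubini on the square over \<open>{a..x}\<close>, cut along the diagonal: each triangle
  yields one of the two integrals. This is integration by parts for primitives and the source of the
  product rule, with no differentiation at points.\<close>

lemma integral_times_integral:
  fixes g h :: "real \<Rightarrow> complex"
  assumes g: "g absolutely_integrable_on {a..x}" and h: "h absolutely_integrable_on {a..x}"
  shows "integral {a..x} g * integral {a..x} h =
    integral {a..x} (\<lambda>s. g s * integral {a..s} h) + integral {a..x} (\<lambda>t. integral {a..t} g * h t)"
proof -
  define N where "N = lebesgue_on {a..x}"
  interpret N: finite_measure N
    unfolding N_def by (rule finite_measure_lebesgue_on) auto
  interpret P: pair_sigma_finite N N ..
  have sp: "space N = {a..x}" by (simp add: N_def)
  have gi: "integrable N g" and hi: "integrable N h"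
    using assms by (auto simp: N_def intro: absolutely_integrable_imp_integrable)
  have [measurable]: "g \<in> borel_measurable N" "h \<in> borel_measurable N"
    using gi hi by auto
  have idm: "(\<lambda>x. x) \<in> borel_measurable N"
    unfolding N_def by (rule continuous_imp_measurable_on_sets_lebesgue) auto
  have [measurable]: "(\<lambda>p. fst p :: real) \<in> borel_measurable (N \<Otimes>\<^sub>M N)"
    "(\<lambda>p. snd p :: real) \<in> borel_measurable (N \<Otimes>\<^sub>M N)"
    using measurable_compose[OF measurable_fst idm] measurable_compose[OF measurable_snd idm]
    by auto
  define G where "G = (\<lambda>p. g (fst p) * h (snd p))"
  \<comment> \<open>The closed half \<open>t \<le> s\<close> goes to the first integral. Its
    complement is the open half, so the slices there are \<open>{a..<t}\<close>, which is why
    \<open>inner'\<close> has to discard a single point.\<close>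
  define T where "T = {p \<in> space (N \<Otimes>\<^sub>M N). snd p \<le> fst p}"
  have [measurable]: "T \<in> sets (N \<Otimes>\<^sub>M N)" unfolding T_def by measurable
  have Gm [measurable]: "G \<in> borel_measurable (N \<Otimes>\<^sub>M N)" unfolding G_def by measurable
  have Gi: "integrable (N \<Otimes>\<^sub>M N) G"
  proof (rule P.Fubini_integrable)
    show "integrable N (\<lambda>x. LINT y|N. norm (G (x, y)))"
      using gi by (simp add: G_def norm_mult)
    show "AE x in N. integrable N (\<lambda>y. G (x, y))"
      using hi by (simp add: G_def)
  qed simp
  have G1: "integrable (N \<Otimes>\<^sub>M N) (\<lambda>p. indicator T p *\<^sub>R G p)"
    and G2: "integrable (N \<Otimes>\<^sub>M N) (\<lambda>p. indicator (space (N \<Otimes>\<^sub>M N) - T) p *\<^sub>R G p)"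
    by (auto intro!: integrable_mult_indicator Gi)
  have sub: "f absolutely_integrable_on {a..s}" if "s \<in> {a..x}" "f absolutely_integrable_on {a..x}" 
    for s and f :: "real \<Rightarrow> complex"
    using that by (auto intro: absolutely_integrable_on_subinterval)
  have inner: "(LINT t|N. indicator {a..s} t *\<^sub>R f t) = integral {a..s} f"
    if "s \<in> {a..x}" "f absolutely_integrable_on {a..x}" for s and f :: "real \<Rightarrow> complex"
  proof -
    have "(LINT t|N. indicator {a..s} t *\<^sub>R f t) = (LINT t:{a..s}|lebesgue. f t)"
      unfolding N_def set_lebesgue_integral_def using that
      by (subst integral_restrict_space) (auto intro!: Bochner_Integration.integral_cong simp: indicator_def)
    then show ?thesis using sub[OF that] set_lebesgue_integral_eq_integral(2) by metis
  qed
  have inner': "(LINT t|N. indicator {a..<s} t *\<^sub>R f t) = integral {a..s} f"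
    if "s \<in> {a..x}" "f absolutely_integrable_on {a..x}" for s and f :: "real \<Rightarrow> complex"
  proof -
    have "(LINT t|N. indicator {a..<s} t *\<^sub>R f t) = (LINT t|N. indicator {a..s} t *\<^sub>R f t)"
    proof (rule integral_cong_AE)
      have "AE t in lebesgue. t \<noteq> s"
        using AE_lborel_singleton[of s] by (simp add: AE_completion)
      then show "AE t in N. indicat_real {a..<s} t *\<^sub>R f t = indicat_real {a..s} t *\<^sub>R f t"
        unfolding N_def by (subst AE_restrict_space_iff) (auto simp: indicator_def)
    next
      have [measurable]: "f \<in> borel_measurable N"
        using that by (auto simp: N_def intro: absolutely_integrable_imp_borel_measurable)
      have [measurable]: "{a..<s} \<in> sets N" "{a..s} \<in> sets N"
        using that by (auto simp: N_def sets_restrict_space image_iff intro!: exI[of _ "{a..<s}"] exI[of _ "{a..s}"])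
      show "(\<lambda>t. indicat_real {a..<s} t *\<^sub>R f t) \<in> borel_measurable N"
        "(\<lambda>t. indicat_real {a..s} t *\<^sub>R f t) \<in> borel_measurable N"
        by measurable
    qed
    then show ?thesis using inner that by simp
  qed
  have whole: "(LINT t|N. f t) = integral {a..x} f"
    if "f absolutely_integrable_on {a..x}" for f :: "real \<Rightarrow> complex"
    unfolding N_def using that
    by (intro lebesgue_integral_eq_integral absolutely_integrable_imp_integrable) auto
  have cont: "continuous_on {a..x} (\<lambda>s. integral {a..s} f)"
    if "f absolutely_integrable_on {a..x}" for f :: "real \<Rightarrow> complex"
    using that by (simp add: indefinite_integral_continuous_1 set_lebesgue_integral_eq_integral(1))
  have "integral\<^sup>L (N \<Otimes>\<^sub>M N) G = (LINT s|N. LINT t|N. G (s, t))"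
    using P.integral_fst'[OF Gi] by simp
  also have "\<dots> = integral {a..x} g * integral {a..x} h"
    using gi hi by (simp add: G_def whole g h)
  finally have e0: "integral\<^sup>L (N \<Otimes>\<^sub>M N) G = integral {a..x} g * integral {a..x} h" .
  have "integral\<^sup>L (N \<Otimes>\<^sub>M N) (\<lambda>p. indicator T p *\<^sub>R G p) = (LINT s|N. LINT t|N. indicator T (s,t) *\<^sub>R G (s, t))"
    using P.integral_fst'[OF G1] by simp
  also have "\<dots> = (LINT s|N. g s * integral {a..s} h)"
  proof (rule Bochner_Integration.integral_cong)
    fix s assume s: "s \<in> space N"
    have "(LINT t|N. indicator T (s,t) *\<^sub>R G (s, t)) = (LINT t|N. g s * (indicator {a..s} t *\<^sub>R h t))"
      using s by (intro Bochner_Integration.integral_cong) (auto simp: T_def G_def indicator_def space_pair_measure sp)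
    also have "\<dots> = g s * (LINT t|N. indicator {a..s} t *\<^sub>R h t)"
      by (rule integral_mult_right_zero)
    also have "\<dots> = g s * integral {a..s} h"
      using inner[OF _ h, of s] s by (simp add: sp)
    finally show "(LINT t|N. indicator T (s,t) *\<^sub>R G (s, t)) = g s * integral {a..s} h" .
  qed simp
  also have "\<dots> = integral {a..x} (\<lambda>s. g s * integral {a..s} h)"
    using absolutely_integrable_on_Icc_mult_continuous[OF g cont[OF h]]
    by (intro whole) (simp add: mult.commute)
  finally have e1: "integral\<^sup>L (N \<Otimes>\<^sub>M N) (\<lambda>p. indicator T p *\<^sub>R G p) = integral {a..x} (\<lambda>s. g s * integral {a..s} h)" .
  have "integral\<^sup>L (N \<Otimes>\<^sub>M N) (\<lambda>p. indicator (space (N \<Otimes>\<^sub>M N) - T) p *\<^sub>R G p)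
     = (LINT t|N. LINT s|N. indicator (space (N \<Otimes>\<^sub>M N) - T) (s,t) *\<^sub>R G (s, t))"
    using P.integral_snd[of "\<lambda>s t. indicator (space (N \<Otimes>\<^sub>M N) - T) (s,t) *\<^sub>R G (s, t)"] G2
    by (simp add: case_prod_unfold)
  also have "\<dots> = (LINT t|N. integral {a..t} g * h t)"
  proof (rule Bochner_Integration.integral_cong)
    fix t assume t: "t \<in> space N"
    have "(LINT s|N. indicator (space (N \<Otimes>\<^sub>M N) - T) (s,t) *\<^sub>R G (s, t)) = (LINT s|N. (indicator {a..<t} s *\<^sub>R g s) * h t)"
      using t by (intro Bochner_Integration.integral_cong) (auto simp: T_def G_def indicator_def space_pair_measure sp)
    also have "\<dots> = (LINT s|N. indicator {a..<t} s *\<^sub>R g s) * h t"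
      by (rule integral_mult_left_zero)
    also have "\<dots> = integral {a..t} g * h t"
      using inner'[OF _ g, of t] t by (simp add: sp)
    finally show "(LINT s|N. indicator (space (N \<Otimes>\<^sub>M N) - T) (s,t) *\<^sub>R G (s, t)) = integral {a..t} g * h t" .
  qed simp
  also have "\<dots> = integral {a..x} (\<lambda>t. integral {a..t} g * h t)"
    using absolutely_integrable_on_Icc_mult_continuous[OF h cont[OF g]] by (intro whole)
  finally have e2: "integral\<^sup>L (N \<Otimes>\<^sub>M N) (\<lambda>p. indicator (space (N \<Otimes>\<^sub>M N) - T) p *\<^sub>R G p)
    = integral {a..x} (\<lambda>t. integral {a..t} g * h t)" .
  have "integral\<^sup>L (N \<Otimes>\<^sub>M N) G = integral\<^sup>L (N \<Otimes>\<^sub>M N)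
     (\<lambda>p. indicator T p *\<^sub>R G p + indicator (space (N \<Otimes>\<^sub>M N) - T) p *\<^sub>R G p)"
    by (intro Bochner_Integration.integral_cong) (auto simp: indicator_def)
  also have "\<dots> = integral {a..x} (\<lambda>s. g s * integral {a..s} h) + integral {a..x} (\<lambda>t. integral {a..t} g * h t)"
    using G1 G2 by (simp add: e1 e2)
  finally show ?thesis using e0 by simp
qed

text \<open>Absolute continuity, encoded by the fundamental theorem of calculus: the density
  \<open>g\<close> matters only up to null sets, and nothing is differentiated at points.\<close>

definition has_ac_derivative :: "(real \<Rightarrow> complex) \<Rightarrow> (real \<Rightarrow> complex) \<Rightarrow> real \<Rightarrow> real \<Rightarrow> bool" where
  "has_ac_derivative F g a b \<longleftrightarrow>
     g absolutely_integrable_on {a..b} \<and> (\<forall>x\<in>{a..b}. F x = F a + integral {a..x} g)"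

lemma has_ac_derivativeD:
  assumes "has_ac_derivative F g a b"
  shows "g absolutely_integrable_on {a..b}" "x \<in> {a..b} \<Longrightarrow> F x = F a + integral {a..x} g"
  using assms unfolding has_ac_derivative_def by blast+

lemma has_ac_derivative_primitive:
  assumes "g absolutely_integrable_on {a..b}" "\<And>x. x \<in> {a..b} \<Longrightarrow> F x = c + integral {a..x} g"
  shows "has_ac_derivative F g a b"
proof -
  have "F a = c" if "a \<le> b" using that assms(2)[of a] by simp
  then have "F x = F a + integral {a..x} g" if "x \<in> {a..b}" for x
    using assms(2)[OF that] that by simp
  then show ?thesis using assms(1) unfolding has_ac_derivative_def by blast
qed

lemma has_ac_derivative_integrable_on:
  assumes "has_ac_derivative F g a b" "x \<in> {a..b}"
  shows "g integrable_on {a..x}"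
proof -
  have "g absolutely_integrable_on {a..x}"
    by (rule absolutely_integrable_on_subinterval[OF has_ac_derivativeD(1)[OF assms(1)]]) (use assms(2) in auto)
  then show ?thesis by (rule set_lebesgue_integral_eq_integral)
qed

lemma has_ac_derivative_continuous_on:
  assumes "has_ac_derivative F g a b"
  shows "continuous_on {a..b} F"
proof -
  have "continuous_on {a..b} (\<lambda>x. F a + integral {a..x} g)"
    using assms by (intro continuous_intros indefinite_integral_continuous_1)
      (simp add: has_ac_derivative_def set_lebesgue_integral_eq_integral(1))
  then show ?thesis
    by (rule continuous_on_eq) (rule has_ac_derivativeD(2)[OF assms, symmetric])
qed

lemma has_ac_derivative_cong:
  assumes "has_ac_derivative F g a b"
    and "\<And>x. x \<in> {a..b} \<Longrightarrow> F x = F' x" "\<And>x. x \<in> {a..b} \<Longrightarrow> g x = g' x"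
  shows "has_ac_derivative F' g' a b"
proof (rule has_ac_derivative_primitive)
  show "g' absolutely_integrable_on {a..b}"
    using has_ac_derivativeD(1)[OF assms(1)] unfolding set_integrable_def
    by (rule Bochner_Integration.integrable_cong[THEN iffD1, OF refl, rotated]) (use assms(3) in \<open>auto simp: indicator_def\<close>)
  fix x assume x: "x \<in> {a..b}"
  have "integral {a..x} g = integral {a..x} g'"
    using x assms(3) by (intro integral_cong) auto
  then show "F' x = F a + integral {a..x} g'"
    using assms(2)[OF x] has_ac_derivativeD(2)[OF assms(1) x] by simp
qed

lemma has_ac_derivative_add:
  assumes "has_ac_derivative F f a b" "has_ac_derivative G g a b"
  shows "has_ac_derivative (\<lambda>x. F x + G x) (\<lambda>x. f x + g x) a b"
proof (rule has_ac_derivative_primitive)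
  show "(\<lambda>x. f x + g x) absolutely_integrable_on {a..b}"
    using assms by (auto simp: has_ac_derivative_def)
  fix x assume x: "x \<in> {a..b}"
  show "F x + G x = (F a + G a) + integral {a..x} (\<lambda>x. f x + g x)"
    using has_ac_derivative_integrable_on[OF assms(1) x] has_ac_derivative_integrable_on[OF assms(2) x]
      has_ac_derivativeD(2)[OF assms(1) x] has_ac_derivativeD(2)[OF assms(2) x]
    by (simp add: integral_add)
qed

lemma has_ac_derivative_cmult:
  assumes "has_ac_derivative F f a b"
  shows "has_ac_derivative (\<lambda>x. c * F x) (\<lambda>x. c * f x) a b"
proof (rule has_ac_derivative_primitive)
  show "(\<lambda>x. c * f x) absolutely_integrable_on {a..b}"
    using assms by (auto simp: has_ac_derivative_def)
  fix x assume x: "x \<in> {a..b}"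
  show "c * F x = c * F a + integral {a..x} (\<lambda>x. c * f x)"
    using has_ac_derivativeD(2)[OF assms x] by (simp add: ring_distribs)
qed

lemma has_ac_derivative_const: "has_ac_derivative (\<lambda>x. c) (\<lambda>x. 0) a b"
  by (auto simp: has_ac_derivative_def)

lemma has_ac_derivative_diff:
  assumes "has_ac_derivative F f a b" "has_ac_derivative G g a b"
  shows "has_ac_derivative (\<lambda>x. F x - G x) (\<lambda>x. f x - g x) a b"
  using has_ac_derivative_add[OF assms(1) has_ac_derivative_cmult[OF assms(2), of "-1"]] by simp

text \<open>Both factors are replaced by value at \<open>a\<close> plus integral. Terms with a
  constant factor are linear; the product of the two integrals is
  \<open>integral_times_integral\<close>.\<close>

lemma has_ac_derivative_mult:
  assumes F: "has_ac_derivative F f a b" and G: "has_ac_derivative G g a b"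
  shows "has_ac_derivative (\<lambda>x. F x * G x) (\<lambda>x. f x * G x + F x * g x) a b"
proof (rule has_ac_derivative_primitive)
  have fG: "(\<lambda>x. G x * f x) absolutely_integrable_on {a..b}" 
    and Fg: "(\<lambda>x. F x * g x) absolutely_integrable_on {a..b}"
    by (intro absolutely_integrable_on_Icc_mult_continuous has_ac_derivativeD(1)[OF F]
      has_ac_derivativeD(1)[OF G] has_ac_derivative_continuous_on[OF F] has_ac_derivative_continuous_on[OF G])+
  then show "(\<lambda>x. f x * G x + F x * g x) absolutely_integrable_on {a..b}"
    using set_integral_add(1)[OF fG Fg] by (simp add: mult.commute)
  fix x assume x: "x \<in> {a..b}"
  have sub: "f' absolutely_integrable_on {a..x}" if "f' absolutely_integrable_on {a..b}" 
    for f' :: "real \<Rightarrow> complex"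
    using x that by (auto intro: absolutely_integrable_on_subinterval)
  have f: "f absolutely_integrable_on {a..x}" and g: "g absolutely_integrable_on {a..x}"
    by (intro sub has_ac_derivativeD(1)[OF F] has_ac_derivativeD(1)[OF G])+
  note ii = set_lebesgue_integral_eq_integral(1)
  have cont: "continuous_on {a..x} (\<lambda>s. integral {a..s} h)"
    if "h absolutely_integrable_on {a..x}" for h :: "real \<Rightarrow> complex"
    using that by (simp add: indefinite_integral_continuous_1 ii)
  have *: "(\<lambda>s. f s * integral {a..s} g) integrable_on {a..x}"
    "(\<lambda>s. integral {a..s} f * g s) integrable_on {a..x}"
    using ii[OF absolutely_integrable_on_Icc_mult_continuous[OF f cont[OF g]]]
      ii[OF absolutely_integrable_on_Icc_mult_continuous[OF g cont[OF f]]]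
    by (simp_all add: mult.commute)
  have "integral {a..x} (\<lambda>x. f x * G x + F x * g x) = integral {a..x} (\<lambda>s.
      (f s * G a + f s * integral {a..s} g) + (F a * g s + integral {a..s} f * g s))"
  proof (rule integral_cong)
    fix s assume "s \<in> {a..x}"
    then have s: "s \<in> {a..b}" using x by auto
    show "f s * G s + F s * g s = 
      (f s * G a + f s * integral {a..s} g) + (F a * g s + integral {a..s} f * g s)"
      using has_ac_derivativeD(2)[OF F s] has_ac_derivativeD(2)[OF G s] by (simp add: algebra_simps)
  qed
  also have "\<dots> = integral {a..x} (\<lambda>s. f s * G a + f s * integral {a..s} g) 
       + integral {a..x} (\<lambda>s. F a * g s + integral {a..s} f * g s)"
    using * f g by (intro integral_add integrable_add integrable_on_cmult_left
         integrable_on_cmult_right) (auto simp: ii)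
  also have "\<dots> = integral {a..x} (\<lambda>s. f s * G a) + integral {a..x} (\<lambda>s. f s * integral {a..s} g) 
       + (integral {a..x} (\<lambda>s. F a * g s) + integral {a..x} (\<lambda>s. integral {a..s} f * g s))"
    using * f g by (intro arg_cong2[where f="(+)"] integral_add integrable_on_cmult_left
         integrable_on_cmult_right) (auto simp: ii)
  also have "\<dots> = integral {a..x} f * G a + F a * integral {a..x} g + integral {a..x} f * integral {a..x} g"
    by (simp add: integral_times_integral[OF f g])
  finally show "F x * G x = F a * G a + integral {a..x} (\<lambda>x. f x * G x + F x * g x)"
    using has_ac_derivativeD(2)[OF F x] has_ac_derivativeD(2)[OF G x] by (simp add: algebra_simps)
qed

lemma has_ac_derivative_C1:
  assumes "\<And>x. x \<in> {a..b} \<Longrightarrow> (F has_vector_derivative f x) (at x within {a..b})" "continuous_on {a..b} f"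
  shows "has_ac_derivative F f a b"
proof -
  have int: "(f has_integral F x - F a) {a..x}" if "x \<in> {a..b}" for x
  proof (rule fundamental_theorem_of_calculus)
    fix t assume "t \<in> {a..x}"
    then show "(F has_vector_derivative f t) (at t within {a..x})"
      using that by (intro has_vector_derivative_within_subset[OF assms(1)]) auto
  qed (use that in auto)
  have "F x = F a + integral {a..x} f" if "x \<in> {a..b}" for x
    using integral_unique[OF int[OF that]] by simp
  then show ?thesis
    by (rule has_ac_derivative_primitive[OF absolutely_integrable_continuous_real[OF assms(2)]])
qed

lemma has_ac_derivative_power:
  assumes P: "has_ac_derivative P q a b"
  shows "has_ac_derivative (\<lambda>x. P x ^ n) (\<lambda>x. of_nat n * P x ^ (n-1) * q x) a b"
proof (induction n)
  case (Suc n)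
  then have "has_ac_derivative (\<lambda>x. P x * P x ^ n) (\<lambda>x. q x * P x ^ n + P x * (of_nat n * P x ^ (n-1) * q x)) a b"
    using P by (intro has_ac_derivative_mult)
  then show ?case by (rule has_ac_derivative_cong) (cases n; auto simp: algebra_simps)+
qed (use has_ac_derivative_const in auto)

text \<open>The partial sums of the exponential series are polynomials in \<open>P\<close>, covered
  by the power rule, and the integral formula passes to the limit by dominated convergence with
  majorant \<open>exp B * norm (q t)\<close>.\<close>

lemma has_ac_derivative_exp:
  assumes P: "has_ac_derivative P q a b"
  shows "has_ac_derivative (\<lambda>x. exp (P x)) (\<lambda>x. exp (P x) * q x) a b"
proof (rule has_ac_derivative_primitive[where c = "exp (P a)"])
  have q: "q absolutely_integrable_on {a..b}" using P by (rule has_ac_derivativeD)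
  have cont: "continuous_on {a..b} P" using P by (rule has_ac_derivative_continuous_on)
  show "(\<lambda>x. exp (P x) * q x) absolutely_integrable_on {a..b}"
    using q cont by (intro absolutely_integrable_on_Icc_mult_continuous continuous_intros)
  fix x assume x: "x \<in> {a..b}"
  have "bounded (P ` {a..b})"
    using cont by (intro compact_imp_bounded compact_continuous_image) auto
  then obtain B where B: "\<And>s. s \<in> {a..b} \<Longrightarrow> norm (P s) \<le> B"
    unfolding bounded_iff by blast
  define S where "S n t = (\<Sum>k<n. P t ^ k /\<^sub>R fact k)" for n t
  define S' where "S' n t = (\<Sum>k<n. (of_nat k * P t ^ (k-1) * q t) /\<^sub>R fact k)" for n t
  have ac: "has_ac_derivative (S n) (S' n) a b" for n
  proof (induction n)
    case 0 then show ?case using has_ac_derivative_const[of 0] by (simp add: S_def S'_def)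
  next
    case (Suc n)
    have "has_ac_derivative (\<lambda>x. S n x + of_real (inverse (fact n)) * P x ^ n)
     (\<lambda>x. S' n x + of_real (inverse (fact n)) * (of_nat n * P x ^ (n-1) * q x)) a b"
      by (intro has_ac_derivative_add Suc has_ac_derivative_cmult has_ac_derivative_power P)
    then show ?case by (rule has_ac_derivative_cong) (auto simp: S_def S'_def scaleR_conv_of_real)
  qed
  \<comment> \<open>Termwise differentiation lowers the index: the constant term drops out, so the
    derivative of the sum with \<open>n + 1\<close> terms is the sum with \<open>n\<close> terms
    times \<open>q\<close>. Hence the limits below run over \<open>Suc n\<close>.\<close>
  have S': "S' (Suc n) t = S n t * q t" for n t
  proof -
    have "S' (Suc n) t = (\<Sum>k<n. (of_nat (Suc k) * P t ^ k * q t) /\<^sub>R fact (Suc k))"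
      unfolding S'_def by (subst sum.lessThan_Suc_shift) simp
    also have "\<dots> = (\<Sum>k<n. P t ^ k /\<^sub>R fact k * q t)"
    proof (rule sum.cong)
      fix k
      have "inverse (fact (Suc k) :: real) = inverse (fact k) * inverse (real (Suc k))" by simp
      then have "(of_nat (Suc k) * P t ^ k * q t) /\<^sub>R fact (Suc k) =
        (complex_of_real (inverse (real (Suc k))) * of_nat (Suc k)) * (P t ^ k /\<^sub>R fact k * q t)"
        by (simp only: scaleR_conv_of_real of_real_mult mult_ac)
      also have "complex_of_real (inverse (real (Suc k))) * of_nat (Suc k) = 1"
        by (simp del: of_nat_Suc)
      finally show "(of_nat (Suc k) * P t ^ k * q t) /\<^sub>R fact (Suc k) = P t ^ k /\<^sub>R fact k * q t"
        by simp
    qed simp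
    finally show ?thesis by (simp only: S_def sum_distrib_right)
  qed
  have Slim: "(\<lambda>n. S n t) \<longlonglongrightarrow> exp (P t)" for t
    unfolding S_def using exp_converges[of "P t"] by (simp add: sums_def)
  have Sb: "norm (S n t) \<le> exp B" if "t \<in> {a..b}" for n t
  proof -
    have "norm (S n t) \<le> (\<Sum>k<n. norm (P t) ^ k /\<^sub>R fact k)"
      unfolding S_def by (rule order_trans[OF norm_sum]) (simp add: norm_power)
    also have "\<dots> \<le> exp (norm (P t))"
      using exp_converges[of "norm (P t)"] by (intro sum_le_suminf[THEN order_trans]) 
         (auto simp: sums_iff)
    finally show ?thesis using B[OF that] by (meson exp_le_cancel_iff order_trans)
  qed
  have lim: "(\<lambda>n. integral {a..x} (S' (Suc n))) \<longlonglongrightarrow> integral {a..x} (\<lambda>t. exp (P t) * q t)"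
  proof (rule dominated_convergence(2))
    show "S' (Suc n) integrable_on {a..x}" for n
      using has_ac_derivative_integrable_on[OF ac x] .
    have "(\<lambda>t. norm (q t)) integrable_on {a..x}"
      using q x absolutely_integrable_on_subinterval[OF q, of a x] 
      by (auto simp: absolutely_integrable_on_def)
    then show "(\<lambda>t. exp B * norm (q t)) integrable_on {a..x}" by simp
    fix n t assume "t \<in> {a..x}"
    then show "norm (S' (Suc n) t) \<le> exp B * norm (q t)"
      using x Sb[of t n] by (auto simp: S' norm_mult intro!: mult_right_mono)
  next
    fix t show "(\<lambda>n. S' (Suc n) t) \<longlonglongrightarrow> exp (P t) * q t"
      unfolding S' by (intro tendsto_intros Slim)
  qed
  have "(\<lambda>n. S (Suc n) x) \<longlonglongrightarrow> exp (P a) + integral {a..x} (\<lambda>t. exp (P t) * q t)"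
    by (subst has_ac_derivativeD(2)[OF ac x]) (intro tendsto_intros LIMSEQ_Suc Slim lim)
  moreover have "(\<lambda>n. S (Suc n) x) \<longlonglongrightarrow> exp (P x)" by (intro LIMSEQ_Suc Slim)
  ultimately show "exp (P x) = exp (P a) + integral {a..x} (\<lambda>t. exp (P t) * q t)"
    using LIMSEQ_unique by blast
qed

section \<open>Square-integrable functions\<close>

definition L2 :: "'a measure \<Rightarrow> ('a \<Rightarrow> complex) set" where
  "L2 M = {f \<in> borel_measurable M. integrable M (\<lambda>x. (cmod (f x))\<^sup>2)}"

text \<open>The square of the L2 norm. Staying with squares keeps everything quadratic in the
  function and free of roots; the triangle inequality becomes \<open>sqnorm_add_le\<close> with
  factors 2.\<close>

definition sqnorm :: "'a measure \<Rightarrow> ('a \<Rightarrow> complex) \<Rightarrow> real" where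
  "sqnorm M f = (LINT x|M. (cmod (f x))\<^sup>2)"

lemma L2_measurable [measurable_dest]: "f \<in> L2 M \<Longrightarrow> f \<in> borel_measurable M"
  and L2_integrable: "f \<in> L2 M \<Longrightarrow> integrable M (\<lambda>x. (cmod (f x))\<^sup>2)"
  by (auto simp: L2_def)

lemma sqnorm_nonneg [simp]: "sqnorm M f \<ge> 0"
  by (simp add: sqnorm_def)

lemma L2_cmult: "f \<in> L2 M \<Longrightarrow> (\<lambda>x. c * f x) \<in> L2 M"
  by (auto simp: L2_def norm_mult power_mult_distrib)

lemma L2_cnj: "f \<in> L2 M \<Longrightarrow> (\<lambda>x. cnj (f x)) \<in> L2 M"
  using borel_measurable_continuous_onI[of cnj] measurable_compose[of f M borel cnj borel]
  by (auto simp: L2_def continuous_on_cnj)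

lemma norm_add_sq_le: "(norm (x + y :: 'a :: real_normed_vector))\<^sup>2 \<le> 2 * (norm x)\<^sup>2 + 2 * (norm y)\<^sup>2"
proof -
  have "(norm (x + y))\<^sup>2 \<le> (norm x + norm y)\<^sup>2"
    by (intro power_mono norm_triangle_ineq) simp
  also have "\<dots> \<le> 2 * (norm x)\<^sup>2 + 2 * (norm y)\<^sup>2"
    using sum_squares_bound[of "norm x" "norm y"] by (simp add: power2_sum)
  finally show ?thesis .
qed

lemma L2_add:
  assumes "f \<in> L2 M" "g \<in> L2 M"
  shows "(\<lambda>x. f x + g x) \<in> L2 M"
proof -
  have [measurable]: "f \<in> borel_measurable M" "g \<in> borel_measurable M"
    using assms by (auto simp: L2_def)
  have "integrable M (\<lambda>x. (cmod (f x + g x))\<^sup>2)"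
  proof (rule Bochner_Integration.integrable_bound)
    show "integrable M (\<lambda>x. 2 * (cmod (f x))\<^sup>2 + 2 * (cmod (g x))\<^sup>2)"
      using assms by (simp add: L2_integrable)
    show "AE x in M. norm ((cmod (f x + g x))\<^sup>2) \<le> norm (2 * (cmod (f x))\<^sup>2 + 2 * (cmod (g x))\<^sup>2)"
      using norm_add_sq_le by (auto intro!: AE_I2)
  qed simp
  then show ?thesis by (simp add: L2_def)
qed

lemma L2_diff: "f \<in> L2 M \<Longrightarrow> g \<in> L2 M \<Longrightarrow> (\<lambda>x. f x - g x) \<in> L2 M"
  using L2_add[of f M "\<lambda>x. -1 * g x"] L2_cmult[of g M "-1"] by simp

lemma sqnorm_cmult: "sqnorm M (\<lambda>x. c * f x) = (cmod c)\<^sup>2 * sqnorm M f"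
  by (simp add: sqnorm_def norm_mult power_mult_distrib)

lemma sqnorm_add_le:
  assumes "f \<in> L2 M" "g \<in> L2 M"
  shows "sqnorm M (\<lambda>x. f x + g x) \<le> 2 * sqnorm M f + 2 * sqnorm M g"
proof -
  have "sqnorm M (\<lambda>x. f x + g x) \<le> (LINT x|M. 2 * (cmod (f x))\<^sup>2 + 2 * (cmod (g x))\<^sup>2)"
    unfolding sqnorm_def using assms L2_add[OF assms] norm_add_sq_le
    by (intro integral_mono) (auto simp: L2_integrable)
  also have "\<dots> = 2 * sqnorm M f + 2 * sqnorm M g"
    using assms by (simp add: sqnorm_def L2_integrable)
  finally show ?thesis .
qed

lemma L2_integrable_mult:
  assumes "f \<in> L2 M" "g \<in> L2 M"
  shows "integrable M (\<lambda>x. f x * g x)"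
proof (rule Bochner_Integration.integrable_bound)
  have [measurable]: "f \<in> borel_measurable M" "g \<in> borel_measurable M"
    using assms by (auto simp: L2_def)
  show "(\<lambda>x. f x * g x) \<in> borel_measurable M" by simp
  show "integrable M (\<lambda>x. (cmod (f x))\<^sup>2 + (cmod (g x))\<^sup>2)"
    using assms by (simp add: L2_integrable)
  have "cmod (f x) * cmod (g x) \<le> (cmod (f x))\<^sup>2 + (cmod (g x))\<^sup>2" for x
    using sum_squares_bound[of "cmod (f x)" "cmod (g x)"]
      mult_nonneg_nonneg[OF norm_ge_zero norm_ge_zero, of "f x" "g x"] by linarith
  then show "AE x in M. norm (f x * g x) \<le> norm ((cmod (f x))\<^sup>2 + (cmod (g x))\<^sup>2)"
    by (auto intro!: AE_I2 simp: norm_mult)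
qed

text \<open>Expansion of the Hermitian square. It drives the Cauchy-Schwarz inequality, the
  parallelogram identity and the first variation in the Riesz argument.\<close>

lemma sqnorm_add_cmult:
  assumes "f \<in> L2 M" "g \<in> L2 M"
  shows "sqnorm M (\<lambda>x. f x + t * g x) =
    sqnorm M f + (cmod t)\<^sup>2 * sqnorm M g + 2 * Re (t * (LINT x|M. cnj (f x) * g x))"
proof -
  have i: "integrable M (\<lambda>x. cnj (f x) * g x)"
    using assms by (intro L2_integrable_mult L2_cnj)
  have eq: "(cmod (f x + t * g x))\<^sup>2 = (cmod (f x))\<^sup>2 + (cmod t)\<^sup>2 * (cmod (g x))\<^sup>2 + 2 * Re (t * (cnj (f x) * g x))" for x
    unfolding cmod_power2 by (simp add: power2_eq_square algebra_simps)
  have "sqnorm M (\<lambda>x. f x + t * g x) = (LINT x|M. (cmod (f x))\<^sup>2 + (cmod t)\<^sup>2 * (cmod (g x))\<^sup>2 + 2 * Re (t * (cnj (f x) * g x)))"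
    by (simp add: sqnorm_def eq)
  also have "\<dots> = (LINT x|M. (cmod (f x))\<^sup>2 + (cmod t)\<^sup>2 * (cmod (g x))\<^sup>2) + (LINT x|M. 2 * Re (t * (cnj (f x) * g x)))"
    using assms i by (intro Bochner_Integration.integral_add integrable_mult_right integrable_Re
       Bochner_Integration.integrable_add) (auto simp: L2_integrable)
  also have "(LINT x|M. 2 * Re (t * (cnj (f x) * g x))) = 2 * Re (t * (LINT x|M. cnj (f x) * g x))"
    using i by (subst integral_mult_right_zero, subst integral_Re) auto
  finally show ?thesis using assms by (simp add: sqnorm_def L2_integrable)
qed

text \<open>The pairing is bilinear, without a conjugate, to match the action of distributions; so
  the square is expanded around \<open>cnj f\<close> in the direction \<open>g\<close>, with
  coefficient \<open>- s * cnj I\<close>, which makes the cross term real.\<close>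

lemma L2_Cauchy_Schwarz:
  assumes "f \<in> L2 M" "g \<in> L2 M"
  shows "(cmod (LINT x|M. f x * g x))\<^sup>2 \<le> sqnorm M f * sqnorm M g"
proof -
  define I where "I = (LINT x|M. f x * g x)"
  have *: "0 \<le> sqnorm M f + s\<^sup>2 * (cmod I)\<^sup>2 * sqnorm M g - 2 * s * (cmod I)\<^sup>2" for s :: real
  proof -
    have "0 \<le> sqnorm M (\<lambda>x. cnj (f x) + (- of_real s * cnj I) * g x)" by simp
    also have "\<dots> = sqnorm M f + s\<^sup>2 * (cmod I)\<^sup>2 * sqnorm M g + 2 * Re (- of_real s * cnj I * I)"
      using assms by (subst sqnorm_add_cmult) (auto simp: L2_cnj norm_mult power_mult_distrib I_def sqnorm_def)
    also have "Re (- of_real s * cnj I * I) = - s * (cmod I)\<^sup>2"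
      unfolding cmod_power2 by (simp add: power2_eq_square algebra_simps)
    finally show ?thesis by simp
  qed
  show ?thesis
  proof (cases "sqnorm M g = 0")
    case True
    have "(cmod I)\<^sup>2 = 0"
    proof (rule ccontr)
      assume nz: "(cmod I)\<^sup>2 \<noteq> 0"
      then have "I \<noteq> 0" by auto
      \<comment> \<open>With \<open>sqnorm M g = 0\<close> the bound is affine in \<open>s\<close>;
        this \<open>s\<close> makes its right side equal to -1.\<close>
      then show False using *[of "(sqnorm M f + 1) / (2 * (cmod I)\<^sup>2)"] True by (simp add: field_simps)
    qed
    then show ?thesis using True by (simp add: I_def)
  next
    case False
    then have pos: "sqnorm M g > 0" using sqnorm_nonneg[of M g] by linarith
    \<comment> \<open>The value \<open>1 / sqnorm M g\<close> for \<open>s\<close> minimises the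
      quadratic.\<close>
    have "0 \<le> sqnorm M f - (cmod I)\<^sup>2 / sqnorm M g"
      using *[of "1 / sqnorm M g"] pos by (simp add: field_simps power2_eq_square)
    then show ?thesis using pos by (simp add: field_simps I_def)
  qed
qed

section \<open>Completeness and Riesz representation\<close>

text \<open>Arithmetic-geometric mean for \<open>2 ^ (k/2) * |d k|\<close> and
  \<open>2 ^ (- k/2)\<close>. It passes from integrals of squared increments to absolute convergence
  at a point without a triangle inequality for norms.\<close>

lemma summable_abs_of_weighted_squares:
  fixes d :: "nat \<Rightarrow> real"
  assumes "summable (\<lambda>k. 2 ^ k * (d k)\<^sup>2)"
  shows "summable (\<lambda>k. \<bar>d k\<bar>)"
proof (rule summable_comparison_test')
  show "summable (\<lambda>k. 2 ^ k * (d k)\<^sup>2 + (1/2) ^ k)"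
    using assms by (intro summable_add summable_geometric) auto
  fix k :: nat
  have "2 * (sqrt (2 ^ k) * \<bar>d k\<bar>) * sqrt ((1/2) ^ k) \<le> (sqrt (2 ^ k) * \<bar>d k\<bar>)\<^sup>2 + (sqrt ((1/2) ^ k))\<^sup>2"
    by (rule sum_squares_bound)
  also have "2 * (sqrt (2 ^ k) * \<bar>d k\<bar>) * sqrt ((1/2) ^ k) = 2 * \<bar>d k\<bar> * sqrt (2 ^ k * (1/2) ^ k)"
    by (simp add: real_sqrt_mult)
  also have "(2::real) ^ k * (1/2) ^ k = 1" by (simp flip: power_mult_distrib)
  finally show "norm \<bar>d k\<bar> \<le> 2 ^ k * (d k)\<^sup>2 + (1/2) ^ k"
    by (simp add: power_mult_distrib)
qed

lemma L2_complete:
  assumes F: "\<And>n. F n \<in> L2 M"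
    and cauchy: "\<And>\<epsilon>. \<epsilon> > 0 \<Longrightarrow> \<exists>N. \<forall>m\<ge>N. \<forall>n\<ge>N. sqnorm M (\<lambda>x. F m x - F n x) < \<epsilon>"
  obtains f where "f \<in> L2 M" "(\<lambda>n. sqnorm M (\<lambda>x. F n x - f x)) \<longlonglongrightarrow> 0"
proof -
  have [measurable]: "F n \<in> borel_measurable M" for n using F by (auto simp: L2_def)
  have "\<forall>k. \<exists>N. \<forall>m\<ge>N. \<forall>n\<ge>N. sqnorm M (\<lambda>x. F m x - F n x) < (1/4) ^ k"
    using cauchy by simp
  then obtain N where N: "\<And>k m n. m \<ge> N k \<Longrightarrow> n \<ge> N k \<Longrightarrow> sqnorm M (\<lambda>x. F m x - F n x) < (1/4) ^ k"
    by metis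
  \<comment> \<open>Monotone indices with \<open>r k\<close> beyond \<open>N k\<close>. The
    threshold \<open>(1/4) ^ k\<close> leaves \<open>(1/2) ^ k\<close> after weighting by
    \<open>2 ^ k\<close>, a summable bound.\<close>
  define r where "r = rec_nat (N 0) (\<lambda>k i. max (N (Suc k)) i)"
  have r_Suc: "r (Suc k) = max (N (Suc k)) (r k)" and r_0: "r 0 = N 0" for k
    by (simp_all add: r_def)
  have rN: "r k \<ge> N k" for k by (cases k) (auto simp: r_Suc r_0)
  have r_mono: "r m \<le> r n" if "m \<le> n" for m n
    using that by (rule lift_Suc_mono_le[of r, rotated]) (simp add: r_Suc)
  define d where "d k x = cmod (F (r (Suc k)) x - F (r k) x)" for k x
  have diffL2: "(\<lambda>x. F m x - F n x) \<in> L2 M" for m n by (intro L2_diff F)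
  have [measurable]: "d k \<in> borel_measurable M" for k unfolding d_def by simp
  have "(\<integral>\<^sup>+x. (\<Sum>k. ennreal (2 ^ k * (d k x)\<^sup>2)) \<partial>M) = (\<Sum>k. \<integral>\<^sup>+x. ennreal (2 ^ k * (d k x)\<^sup>2) \<partial>M)"
    by (intro nn_integral_suminf) simp
  also have "\<dots> \<le> (\<Sum>k. ennreal ((1/2) ^ k))"
  proof (intro suminf_le summableI)
    fix k
    have "(\<integral>\<^sup>+x. ennreal (2 ^ k * (d k x)\<^sup>2) \<partial>M) = ennreal (LINT x|M. 2 ^ k * (d k x)\<^sup>2)"
      using L2_integrable[OF diffL2] by (intro nn_integral_eq_integral) (auto simp: d_def)
    also have "(LINT x|M. 2 ^ k * (d k x)\<^sup>2) = 2 ^ k * sqnorm M (\<lambda>x. F (r (Suc k)) x - F (r k) x)"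
      by (simp add: sqnorm_def d_def)
    also have "\<dots> \<le> 2 ^ k * (1/4) ^ k"
      using N[of k "r (Suc k)" "r k"] rN r_mono[of k "Suc k"] order.trans[OF rN r_mono[of k "Suc k"]]
      by (intro mult_left_mono) auto
    also have "\<dots> = (1/2) ^ k" by (simp flip: power_mult_distrib)
    finally show "(\<integral>\<^sup>+x. ennreal (2 ^ k * (d k x)\<^sup>2) \<partial>M) \<le> ennreal ((1/2) ^ k)"
      by (simp add: ennreal_leI)
  qed
  also have "\<dots> < \<infinity>"
    using summable_geometric[of "1/2 :: real"] by (subst suminf_ennreal2) auto
  finally have "(\<integral>\<^sup>+x. (\<Sum>k. ennreal (2 ^ k * (d k x)\<^sup>2)) \<partial>M) \<noteq> \<infinity>" by simp
  then have "AE x in M. (\<Sum>k. ennreal (2 ^ k * (d k x)\<^sup>2)) \<noteq> \<infinity>"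
    by (intro nn_integral_PInf_AE) auto
  then have conv: "AE x in M. convergent (\<lambda>k. F (r k) x)"
  proof (eventually_elim)
    case (elim x)
    then have "summable (\<lambda>k. 2 ^ k * (d k x)\<^sup>2)"
      by (intro summable_suminf_not_top) auto
    then have "summable (\<lambda>k. norm (F (r (Suc k)) x - F (r k) x))"
      using summable_abs_of_weighted_squares[of "\<lambda>k. d k x"] by (simp add: d_def)
    then have "summable (\<lambda>k. F (r (Suc k)) x - F (r k) x)" by (rule summable_norm_cancel)
    then have "convergent (\<lambda>n. \<Sum>k<n. F (r (Suc k)) x - F (r k) x)"
      by (simp add: summable_iff_convergent)
    then have "convergent (\<lambda>n. F (r n) x - F (r 0) x)" by (simp add: sum_lessThan_telescope[of "\<lambda>k. F (r k) x"])
    then show ?case using convergent_add[OF _ convergent_const[of "F (r 0) x"]] by fastforce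
  qed
  \<comment> \<open>Where the subsequence diverges, \<open>lim\<close> has an unspecified value;
    this happens on a null set only, and measurability of \<open>f\<close> holds all the
    same.\<close>
  define f where "f x = lim (\<lambda>k. F (r k) x)" for x
  have fm [measurable]: "f \<in> borel_measurable M" unfolding f_def by (rule borel_measurable_lim_metric) simp
  have lim: "AE x in M. (\<lambda>k. F (r k) x) \<longlonglongrightarrow> f x"
    using conv by eventually_elim (simp add: f_def convergent_LIMSEQ_iff)
  \<comment> \<open>Fatou's lemma along the subsequence\<close>
  have bound: "(\<integral>\<^sup>+x. ennreal ((cmod (F n x - f x))\<^sup>2) \<partial>M) \<le> ennreal \<epsilon>"
    if N: "\<And>m n. m \<ge> N0 \<Longrightarrow> n \<ge> N0 \<Longrightarrow> sqnorm M (\<lambda>x. F m x - F n x) < \<epsilon>" and n: "n \<ge> N0" and r: "r K \<ge> N0"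
    for n \<epsilon> N0 K
  proof -
    have "(\<integral>\<^sup>+x. ennreal ((cmod (F n x - f x))\<^sup>2) \<partial>M) = (\<integral>\<^sup>+x. liminf (\<lambda>k. ennreal ((cmod (F n x - F (r k) x))\<^sup>2)) \<partial>M)"
    proof (rule nn_integral_cong_AE)
      show "AE x in M. ennreal ((cmod (F n x - f x))\<^sup>2) = liminf (\<lambda>k. ennreal ((cmod (F n x - F (r k) x))\<^sup>2))"
        using lim
      proof eventually_elim
        case (elim x)
        then have "(\<lambda>k. ennreal ((cmod (F n x - F (r k) x))\<^sup>2)) \<longlonglongrightarrow> ennreal ((cmod (F n x - f x))\<^sup>2)"
          by (intro tendsto_ennrealI tendsto_intros)
        then show ?case by (metis lim_imp_Liminf trivial_limit_sequentially)
      qed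
    qed
    also have "\<dots> \<le> liminf (\<lambda>k. \<integral>\<^sup>+x. ennreal ((cmod (F n x - F (r k) x))\<^sup>2) \<partial>M)"
      by (intro nn_integral_liminf) simp
    also have "\<dots> \<le> ennreal \<epsilon>"
    proof (rule Liminf_le)
      show "\<forall>\<^sub>F k in sequentially. (\<integral>\<^sup>+x. ennreal ((cmod (F n x - F (r k) x))\<^sup>2) \<partial>M) \<le> ennreal \<epsilon>"
      proof (rule eventually_sequentiallyI[of K])
        fix k assume "k \<ge> K"
        then have "sqnorm M (\<lambda>x. F n x - F (r k) x) < \<epsilon>"
          using n r r_mono[of K k] by (intro N) auto
        moreover have "(\<integral>\<^sup>+x. ennreal ((cmod (F n x - F (r k) x))\<^sup>2) \<partial>M) = ennreal (sqnorm M (\<lambda>x. F n x - F (r k) x))"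
          unfolding sqnorm_def using L2_integrable[OF diffL2] by (intro nn_integral_eq_integral) auto
        ultimately show "(\<integral>\<^sup>+x. ennreal ((cmod (F n x - F (r k) x))\<^sup>2) \<partial>M) \<le> ennreal \<epsilon>"
          by (simp add: ennreal_leI)
      qed
    qed simp
    finally show ?thesis .
  qed
  have "(\<lambda>x. F (N 0) x - f x) \<in> L2 M"
  proof -
    have "(\<integral>\<^sup>+x. ennreal ((cmod (F (N 0) x - f x))\<^sup>2) \<partial>M) \<le> ennreal 1"
      using N[of 0] by (intro bound[of "N 0" 1 "N 0" 0]) (auto simp: r_0)
    then have "integrable M (\<lambda>x. (cmod (F (N 0) x - f x))\<^sup>2)"
      by (intro integrableI_bounded) (auto intro: le_less_trans)
    then show ?thesis by (simp add: L2_def)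
  qed
  from L2_diff[OF F[of "N 0"] this] have fL2: "f \<in> L2 M" by simp
  have "(\<lambda>n. sqnorm M (\<lambda>x. F n x - f x)) \<longlonglongrightarrow> 0"
  proof (rule LIMSEQ_I)
    fix \<epsilon> :: real assume e: "\<epsilon> > 0"
    then obtain k where k: "(1/4) ^ k < \<epsilon>" using real_arch_pow_inv[of \<epsilon> "1/4"] by auto
    have "sqnorm M (\<lambda>x. F n x - f x) < \<epsilon>" if n: "n \<ge> N k" for n
    proof -
      have "(\<integral>\<^sup>+x. ennreal ((cmod (F n x - f x))\<^sup>2) \<partial>M) = ennreal (sqnorm M (\<lambda>x. F n x - f x))"
        unfolding sqnorm_def using L2_integrable[OF L2_diff[OF F fL2]] by (intro nn_integral_eq_integral) auto
      then have "ennreal (sqnorm M (\<lambda>x. F n x - f x)) \<le> ennreal ((1/4) ^ k)"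
        using bound[of "N k" "(1/4) ^ k" n k] N n rN by simp
      then have "sqnorm M (\<lambda>x. F n x - f x) \<le> (1/4) ^ k" by (subst (asm) ennreal_le_iff) auto
      then show ?thesis using k by simp
    qed
    then show "\<exists>no. \<forall>n\<ge>no. norm (sqnorm M (\<lambda>x. F n x - f x) - 0) < \<epsilon>"
      by (intro exI[of _ "N k"]) simp
  qed
  with fL2 that show ?thesis by blast
qed

text \<open>The function \<open>h\<close> is the limit of a minimising sequence of \<open>\<parallel>T v\<parallel>\<^sup>2 - 2 Re (l v)\<close>, which is
  Cauchy by the parallelogram identity. That \<open>h\<close> is approximated from \<open>T ` V\<close> also yields density
  results.\<close>

lemma L2_Riesz:
  fixes V :: "('b \<Rightarrow> complex) set"
  assumes V0: "v0 \<in> V"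
    and Vadd: "\<And>u v. u \<in> V \<Longrightarrow> v \<in> V \<Longrightarrow> (\<lambda>x. u x + v x) \<in> V"
    and Vmult: "\<And>c v. v \<in> V \<Longrightarrow> (\<lambda>x. c * v x) \<in> V"
    and T: "\<And>v. v \<in> V \<Longrightarrow> T v \<in> L2 M"
    and Tadd: "\<And>u v. u \<in> V \<Longrightarrow> v \<in> V \<Longrightarrow> T (\<lambda>x. u x + v x) = (\<lambda>x. T u x + T v x)"
    and Tmult: "\<And>c v. v \<in> V \<Longrightarrow> T (\<lambda>x. c * v x) = (\<lambda>x. c * T v x)"
    and ladd: "\<And>u v. u \<in> V \<Longrightarrow> v \<in> V \<Longrightarrow> l (\<lambda>x. u x + v x) = l u + l v"
    and lmult: "\<And>c v. v \<in> V \<Longrightarrow> l (\<lambda>x. c * v x) = c * l v"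
    and bound: "\<And>v. v \<in> V \<Longrightarrow> (cmod (l v))\<^sup>2 \<le> C * sqnorm M (T v)"
  obtains h v where "h \<in> L2 M" "\<And>n. v n \<in> V" "(\<lambda>n. sqnorm M (\<lambda>x. T (v n) x - h x)) \<longlonglongrightarrow> 0"
    "\<And>w. w \<in> V \<Longrightarrow> l w = (LINT x|M. cnj (h x) * T w x)"
proof -
  define \<Phi> where "\<Phi> v = sqnorm M (T v) - 2 * Re (l v)" for v
  \<comment> \<open>The bound on \<open>l\<close> makes the linear term at most
    \<open>2 * sqrt (|C| * sqnorm M (T v))\<close>, which the quadratic term absorbs.
    \<open>C\<close> may be negative, hence the absolute value.\<close>
  have lower: "\<Phi> v \<ge> - \<bar>C\<bar>" if "v \<in> V" for v
  proof -
    have "2 * Re (l v) \<le> 2 * cmod (l v)" using complex_Re_le_cmod by simp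
    also have "cmod (l v) \<le> sqrt (\<bar>C\<bar> * sqnorm M (T v))"
      using bound[OF that] by (intro real_le_rsqrt) (meson abs_ge_self mult_right_mono order_trans sqnorm_nonneg)
    also have "2 * sqrt (\<bar>C\<bar> * sqnorm M (T v)) \<le> \<bar>C\<bar> + sqnorm M (T v)"
      using sum_squares_bound[of "sqrt \<bar>C\<bar>" "sqrt (sqnorm M (T v))"]
      by (simp add: real_sqrt_mult mult.assoc)
    finally show ?thesis by (simp add: \<Phi>_def)
  qed
  define m where "m = Inf (\<Phi> ` V)"
  have bdd: "bdd_below (\<Phi> ` V)" using lower by (intro bdd_belowI2) auto
  have m_le: "m \<le> \<Phi> v" if "v \<in> V" for v
    unfolding m_def using bdd that by (rule cINF_lower)
  have "\<exists>v\<in>V. \<Phi> v < m + 1 / real (Suc n)" for n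
    using cInf_lessD[of "\<Phi> ` V" "m + 1 / real (Suc n)"] V0 by (auto simp: m_def)
  then obtain v where vV: "\<And>n. v n \<in> V" and v: "\<And>n. \<Phi> (v n) < m + 1 / real (Suc n)"
    by metis
  have TL: "T (v n) \<in> L2 M" for n using T vV by simp
  have par: "sqnorm M (\<lambda>x. T (v i) x - T (v j) x) \<le> 2 * (1 / real (Suc i)) + 2 * (1 / real (Suc j))" for i j
  proof -
    \<comment> \<open>The midpoint of two near-minimisers still has \<open>\<Phi>\<close> at least
      \<open>m\<close>, so by the parallelogram identity the two images must be close.\<close>
    define w where "w = (\<lambda>x. (1/2) * (v i x + v j x))"
    have wV: "w \<in> V" unfolding w_def by (intro Vmult Vadd vV)
    have Tw: "T w = (\<lambda>x. (1/2) * (T (v i) x + 1 * T (v j) x))" 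
      unfolding w_def by (subst Tmult[OF Vadd[OF vV vV]], subst Tadd[OF vV vV]) simp
    have lw: "l w = (1/2) * (l (v i) + l (v j))"
      unfolding w_def by (subst lmult[OF Vadd[OF vV vV]], subst ladd[OF vV vV]) simp
    have "sqnorm M (\<lambda>x. T (v i) x + (-1) * T (v j) x) = 2 * sqnorm M (T (v i)) + 2 * sqnorm M (T (v j)) 
       - 4 * sqnorm M (T w)"
      unfolding Tw sqnorm_cmult sqnorm_add_cmult[OF TL TL] by (simp add: power2_eq_square field_simps)
    also have "\<dots> = 2 * \<Phi> (v i) + 2 * \<Phi> (v j) - 4 * \<Phi> w"
      by (simp add: \<Phi>_def lw add_divide_distrib algebra_simps)
    also have "\<dots> \<le> 2 * (1 / real (Suc i)) + 2 * (1 / real (Suc j))"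
      using v[of i] v[of j] m_le[OF wV] by argo
    finally show ?thesis by simp
  qed
  have "\<exists>N. \<forall>i\<ge>N. \<forall>j\<ge>N. sqnorm M (\<lambda>x. T (v i) x - T (v j) x) < \<epsilon>" if "\<epsilon> > 0" for \<epsilon>
  proof -
    have "\<epsilon> / 4 > 0" using that by simp
    then obtain N where N: "inverse (real (Suc N)) < \<epsilon> / 4" using reals_Archimedean by blast
    have *: "1 / real (Suc i) < \<epsilon> / 4" if "i \<ge> N" for i
    proof -
      have "inverse (real (Suc i)) \<le> inverse (real (Suc N))"
        using that by (intro le_imp_inverse_le) auto
      then show ?thesis using N by (simp only: inverse_eq_divide)
    qed
    have "sqnorm M (\<lambda>x. T (v i) x - T (v j) x) < \<epsilon>" if "i \<ge> N" "j \<ge> N" for i j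
    proof -
      have "1 / real (Suc i) < \<epsilon> / 4" "1 / real (Suc j) < \<epsilon> / 4" using that * by auto
      then show ?thesis using par[of i j] by linarith
    qed
    then show ?thesis by blast
  qed
  from L2_complete[of "\<lambda>n. T (v n)", OF TL this] obtain h where
    h: "h \<in> L2 M" and lim: "(\<lambda>n. sqnorm M (\<lambda>x. T (v n) x - h x)) \<longlonglongrightarrow> 0" by blast
  have "l w = (LINT x|M. cnj (h x) * T w x)" if w: "w \<in> V" for w
  proof -
    \<comment> \<open>The residual of the Euler-Lagrange equation at \<open>v n\<close> in direction
      \<open>w\<close>. As \<open>v n\<close> is minimal up to \<open>1 / (n + 1)\<close>, moving
      along \<open>w\<close> cannot gain more than that, which forces the residual to zero.\<close>
    define D where "D n = l w - (LINT x|M. cnj (T (v n) x) * T w x)" for n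
    define B where "B = sqnorm M (T w)"
    have B: "B \<ge> 0" by (simp add: B_def)
    have Db: "(cmod (D n))\<^sup>2 \<le> (B + 1) * (1 / real (Suc n))" for n
    proof -
      \<comment> \<open>The phase \<open>cnj (D n)\<close> in \<open>t\<close> makes
        \<open>t * D n\<close> real and nonnegative; \<open>B + 1\<close> in place of
        \<open>B\<close> gives \<open>s * B \<le> 1\<close> and covers \<open>B = 0\<close>.\<close>
      define s where "s = 1 / (B + 1)"
      define t where "t = of_real s * cnj (D n)"
      have sB: "s * B \<le> 1" "s > 0" using B by (auto simp: s_def field_simps)
      have "m \<le> \<Phi> (\<lambda>x. v n x + t * w x)" using vV w by (intro m_le Vadd Vmult)
      also have "\<dots> = \<Phi> (v n) + (cmod t)\<^sup>2 * B - 2 * Re (t * D n)"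
        unfolding \<Phi>_def Tadd[OF vV Vmult[OF w]] Tmult[OF w] ladd[OF vV Vmult[OF w]] lmult[OF w]
          sqnorm_add_cmult[OF TL T[OF w]] D_def B_def by (simp add: algebra_simps)
      also have "Re (t * D n) = s * (cmod (D n))\<^sup>2"
        unfolding cmod_power2 by (simp add: t_def power2_eq_square algebra_simps)
      also have "(cmod t)\<^sup>2 = s\<^sup>2 * (cmod (D n))\<^sup>2" by (simp add: t_def norm_mult power_mult_distrib)
      finally have "2 * (s * (cmod (D n))\<^sup>2) - (s * B) * (s * (cmod (D n))\<^sup>2) \<le> 1 / real (Suc n)"
        using v[of n] by (simp add: power2_eq_square algebra_simps)
      moreover have "(s * B) * (s * (cmod (D n))\<^sup>2) \<le> 1 * (s * (cmod (D n))\<^sup>2)"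
        using sB by (intro mult_right_mono) auto
      ultimately have "s * (cmod (D n))\<^sup>2 \<le> 1 / real (Suc n)" by linarith
      then show ?thesis using B by (simp add: s_def field_simps)
    qed
    have Eb: "(cmod (LINT x|M. (cnj (T (v n) x - h x)) * T w x))\<^sup>2 \<le> sqnorm M (\<lambda>x. T (v n) x - h x) * B" for n
      using L2_Cauchy_Schwarz[OF L2_cnj[OF L2_diff[OF TL h]] T[OF w], of n]
      by (simp add: B_def sqnorm_def flip: complex_cnj_diff)
    have D0: "D \<longlonglongrightarrow> 0"
    proof -
      have "(\<lambda>n. 1 / real (Suc n)) \<longlonglongrightarrow> 0"
        using LIMSEQ_Suc[OF lim_1_over_n] by (simp only: comp_def)
      then have *: "(\<lambda>n. (B + 1) * (1 / real (Suc n))) \<longlonglongrightarrow> 0"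
        by (rule tendsto_mult_right_zero)
      have "norm ((cmod (D n))\<^sup>2) \<le> (B + 1) * (1 / real (Suc n))" for n
        using Db[of n] by (simp only: real_norm_def abs_power2)
      then have "(\<lambda>n. (cmod (D n))\<^sup>2) \<longlonglongrightarrow> 0"
        by (intro Lim_null_comparison[OF _ *] always_eventually allI)
      then show ?thesis by (simp add: tendsto_norm_zero_iff)
    qed
    have E0: "(\<lambda>n. LINT x|M. (cnj (T (v n) x - h x)) * T w x) \<longlonglongrightarrow> 0"
    proof -
      have *: "(\<lambda>n. sqnorm M (\<lambda>x. T (v n) x - h x) * B) \<longlonglongrightarrow> 0"
        using lim by (rule tendsto_mult_left_zero)
      have "norm ((cmod (LINT x|M. (cnj (T (v n) x - h x)) * T w x))\<^sup>2) \<le> sqnorm M (\<lambda>x. T (v n) x - h x) * B" for n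
        using Eb[of n] by (simp only: real_norm_def abs_power2)
      then have "(\<lambda>n. (cmod (LINT x|M. (cnj (T (v n) x - h x)) * T w x))\<^sup>2) \<longlonglongrightarrow> 0"
        by (intro Lim_null_comparison[OF _ *] always_eventually allI)
      then show ?thesis by (simp add: tendsto_norm_zero_iff)
    qed
    have "D n + (LINT x|M. (cnj (T (v n) x - h x)) * T w x) = l w - (LINT x|M. cnj (h x) * T w x)" for n
      using L2_integrable_mult[OF L2_cnj[OF TL] T[OF w], of n] L2_integrable_mult[OF L2_cnj[OF h] T[OF w]]
      by (simp add: D_def algebra_simps)
    with tendsto_add[OF D0 E0] show ?thesis by (simp add: LIMSEQ_const_iff)
  qed
  with that h vV lim show ?thesis by blast
qed

section \<open>Smooth functions with compact support\<close>

text \<open>The differentiability clause of \<open>test_function\<close>, set apart from the support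
  condition.\<close>

definition smooth :: "(real \<Rightarrow> complex) \<Rightarrow> bool" where
  "smooth \<phi> \<longleftrightarrow> (\<exists>D. D 0 = \<phi> \<and> (\<forall>n x. (D n has_vector_derivative D (Suc n) x) (at x)))"

text \<open>Iterating one chosen derivative operator on \<open>S\<close> produces the whole sequence
  of derivatives at once, so a family closed under differentiation replaces a formula for the n-th
  derivative.\<close>

lemma smooth_coinduct:
  assumes "f \<in> S"
    and step: "\<And>g. g \<in> S \<Longrightarrow> \<exists>g'\<in>S. \<forall>x. (g has_vector_derivative g' x) (at x)"
  shows "smooth f"
proof -
  obtain d where d: "\<And>g. g \<in> S \<Longrightarrow> d g \<in> S \<and> (\<forall>x. (g has_vector_derivative d g x) (at x))"
    using step by metis
  have "(d ^^ n) f \<in> S" for n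
    by (induction n) (use d assms(1) in auto)
  then show ?thesis
    unfolding smooth_def using d by (intro exI[of _ "\<lambda>n. (d ^^ n) f"]) auto
qed

lemma smooth_cases:
  assumes "smooth f"
  obtains f' where "smooth f'" "\<And>x. (f has_vector_derivative f' x) (at x)"
proof -
  obtain D where D: "D 0 = f" "\<And>n x. (D n has_vector_derivative D (Suc n) x) (at x)"
    using assms unfolding smooth_def by auto
  have "smooth (D 1)"
    unfolding smooth_def using D by (intro exI[of _ "\<lambda>n. D (Suc n)"]) auto
  with that D show ?thesis by force
qed

lemma smooth_antiderivative:
  assumes "smooth f'" "\<And>x. (f has_vector_derivative f' x) (at x)"
  shows "smooth f"
proof -
  obtain D where D: "D 0 = f'" "\<And>n x. (D n has_vector_derivative D (Suc n) x) (at x)"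
    using assms unfolding smooth_def by auto
  show ?thesis
    unfolding smooth_def
    by (rule exI[of _ "case_nat f D"]) (use D assms in \<open>auto split: nat.split\<close>)
qed

lemma smooth_const: "smooth (\<lambda>x. c)"
  unfolding smooth_def
  by (rule exI[of _ "\<lambda>n. if n = 0 then (\<lambda>x. c) else (\<lambda>x. 0)"]) auto

text \<open>Differentiating a product of smooth functions stays in this set by the product rule, so
  \<open>smooth_coinduct\<close> takes the place of the Leibniz formula.\<close>

inductive_set smooth_ring :: "(real \<Rightarrow> complex) set" where
  base: "smooth f \<Longrightarrow> smooth g \<Longrightarrow> (\<lambda>x. f x * g x) \<in> smooth_ring"
| add: "f \<in> smooth_ring \<Longrightarrow> g \<in> smooth_ring \<Longrightarrow> (\<lambda>x. f x + g x) \<in> smooth_ring"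

lemma smooth_smooth_ring: "f \<in> smooth_ring \<Longrightarrow> smooth f"
proof (erule smooth_coinduct)
  fix g assume "g \<in> smooth_ring"
  then show "\<exists>g'\<in>smooth_ring. \<forall>x. (g has_vector_derivative g' x) (at x)"
  proof induction
    case (base f g)
    obtain f' where f': "smooth f'" "\<And>x. (f has_vector_derivative f' x) (at x)"
      using base smooth_cases by blast
    obtain g' where g': "smooth g'" "\<And>x. (g has_vector_derivative g' x) (at x)"
      using base smooth_cases by blast
    show ?case
      using f' g' base by (intro bexI[of _ "\<lambda>x. f x * g' x + f' x * g x"] allI
          has_vector_derivative_mult smooth_ring.intros)
  next
    case (add f g)
    then obtain f' g' where "f' \<in> smooth_ring" "\<And>x. (f has_vector_derivative f' x) (at x)"
      "g' \<in> smooth_ring" "\<And>x. (g has_vector_derivative g' x) (at x)" by blast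
    then show ?case
      by (intro bexI[of _ "\<lambda>x. f' x + g' x"] allI has_vector_derivative_add smooth_ring.intros)
  qed
qed

lemma smooth_mult: "smooth f \<Longrightarrow> smooth g \<Longrightarrow> smooth (\<lambda>x. f x * g x)"
  by (rule smooth_smooth_ring[OF smooth_ring.base])

text \<open>The constant factor 1 turns each summand into a product, hence a member of
  \<open>smooth_ring\<close>.\<close>

lemma smooth_add: "smooth f \<Longrightarrow> smooth g \<Longrightarrow> smooth (\<lambda>x. f x + g x)"
  using smooth_smooth_ring[OF smooth_ring.add[OF smooth_ring.base[OF _ smooth_const[of 1]] smooth_ring.base[OF _ smooth_const[of 1]]]]
  by simp

lemma smooth_affine:
  assumes "smooth f"
  shows "smooth (\<lambda>x. f (c * x + d))"
proof -
  obtain D where D: "D 0 = f" "\<And>n x. (D n has_vector_derivative D (Suc n) x) (at x)"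
    using assms unfolding smooth_def by auto
  have "((\<lambda>x. of_real c ^ n * D n (c * x + d)) has_vector_derivative of_real c ^ Suc n * D (Suc n) (c * x + d)) (at x)" for n x
  proof -
    have "((\<lambda>x. c * x + d) has_vector_derivative c) (at x)"
      by (auto intro!: derivative_eq_intros simp: has_vector_derivative_def)
    from vector_diff_chain_at[OF this D(2)]
    have "((\<lambda>x. D n (c * x + d)) has_vector_derivative c *\<^sub>R D (Suc n) (c * x + d)) (at x)"
      by (simp add: o_def)
    from has_vector_derivative_mult_right[OF this, of "of_real c ^ n"]
    show ?thesis by (simp add: scaleR_conv_of_real mult_ac)
  qed
  then show ?thesis
    unfolding smooth_def by (intro exI[of _ "\<lambda>n x. of_real c ^ n * D n (c * x + d)"]) (auto simp: D)
qed

section \<open>Flat functions, bumps and test functions\<close>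

lemma poly_mult_exp_neg_tendsto_0: "((\<lambda>t :: real. poly p t * exp (- t)) \<longlongrightarrow> 0) at_top"
proof -
  have "((\<lambda>t :: real. \<Sum>i\<le>degree p. coeff p i * (t ^ i / exp t)) \<longlongrightarrow> (\<Sum>i\<le>degree p. coeff p i * 0)) at_top"
    by (intro tendsto_sum tendsto_mult tendsto_const tendsto_power_div_exp_0)
  then show ?thesis
    by (simp add: poly_altdef exp_minus sum_distrib_right divide_inverse mult.assoc)
qed

text \<open>The classical flat function \<open>exp (- 1 / x)\<close>. The polynomial in
  \<open>1 / x\<close> is carried along because derivatives produce one, so that the family over all
  \<open>p\<close> is closed under differentiation.\<close>

definition flat_exp :: "real poly \<Rightarrow> real \<Rightarrow> real" where
  "flat_exp p x = (if x \<le> 0 then 0 else poly p (1 / x) * exp (- (1 / x)))"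

text \<open>With \<open>t = 1 / x\<close> one has \<open>dt/dx = - t^2\<close>, which accounts for
  the factor \<open>[:0, 0, 1:]\<close>. At 0 the difference quotient from the right is
  \<open>t * p(t) * exp (- t)\<close> with \<open>t\<close> tending to infinity.\<close>

lemma has_real_derivative_flat_exp:
  "(flat_exp p has_real_derivative flat_exp ([:0, 0, 1:] * (p - pderiv p)) x) (at x)"
proof -
  consider "x < 0" | "x = 0" | "x > 0" by linarith
  then show ?thesis
  proof cases
    case 1
    have "((\<lambda>x. 0 :: real) has_real_derivative 0) (at x)" by simp
    then have "(flat_exp p has_real_derivative 0) (at x)"
      by (rule has_field_derivative_transform_within_open[of _ _ _ "{..<0}"]) (use 1 in \<open>auto simp: flat_exp_def\<close>)
    then show ?thesis using 1 by (simp add: flat_exp_def)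
  next
    case 3
    have "((\<lambda>x. poly p (1 / x) * exp (- (1 / x))) has_real_derivative 
       poly p (1 / x) * (exp (- (1 / x)) * (1 / x\<^sup>2)) + poly (pderiv p) (1 / x) * (- (1 / x\<^sup>2)) * exp (- (1 / x))) (at x)"
      using 3 by (auto intro!: derivative_eq_intros simp: power2_eq_square)
    then have "(flat_exp p has_real_derivative 
       poly p (1 / x) * (exp (- (1 / x)) * (1 / x\<^sup>2)) + poly (pderiv p) (1 / x) * (- (1 / x\<^sup>2)) * exp (- (1 / x))) (at x)"
      by (rule has_field_derivative_transform_within_open[of _ _ _ "{0<..}"]) (use 3 in \<open>auto simp: flat_exp_def\<close>)
    then show ?thesis using 3 by (simp add: flat_exp_def power2_eq_square field_simps)
  next
    case 2
    have "((\<lambda>h. flat_exp p h / h) \<longlongrightarrow> 0) (at 0)"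
    proof (rule filterlim_split_at)
      show "((\<lambda>h. flat_exp p h / h) \<longlongrightarrow> 0) (at_left 0)"
        by (rule tendsto_eventually) (auto simp: flat_exp_def eventually_at_left_field intro!: exI[of _ "-1"])
      have "((\<lambda>h. poly (pCons 0 p) (inverse h) * exp (- inverse h)) \<longlongrightarrow> 0) (at_right 0)"
        by (rule filterlim_compose[OF poly_mult_exp_neg_tendsto_0 filterlim_inverse_at_top_right])
      then show "((\<lambda>h. flat_exp p h / h) \<longlongrightarrow> 0) (at_right 0)"
        by (rule Lim_transform_eventually)
          (auto simp: flat_exp_def eventually_at_right_field field_simps intro!: exI[of _ 1])
    qed
    then show ?thesis using 2 by (simp add: flat_exp_def has_field_derivative_iff)
  qed
qed

lemma smooth_flat_exp: "smooth (\<lambda>x. of_real (flat_exp p x))"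
proof (rule smooth_coinduct)
  show "(\<lambda>x. of_real (flat_exp p x)) \<in> range (\<lambda>p x. of_real (flat_exp p x))" by auto
  fix g :: "real \<Rightarrow> complex" assume "g \<in> range (\<lambda>p x. of_real (flat_exp p x))"
  then obtain p where g: "g = (\<lambda>x. of_real (flat_exp p x))" by auto
  have "(g has_vector_derivative of_real (flat_exp ([:0, 0, 1:] * (p - pderiv p)) x)) (at x)" for x
    unfolding g using has_real_derivative_flat_exp
    by (intro has_vector_derivative_of_real) (simp add: has_real_derivative_iff_has_vector_derivative)
  then show "\<exists>g'\<in>range (\<lambda>p x. of_real (flat_exp p x)). \<forall>x. (g has_vector_derivative g' x) (at x)"
    by (intro bexI[of _ "\<lambda>x. of_real (flat_exp ([:0, 0, 1:] * (p - pderiv p)) x)"]) auto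
qed

text \<open>The scale \<open>n + 1\<close> drives both exponents to 0 at each inner point, so the
  bumps tend to the indicator of the open interval while staying below 1, as dominated convergence
  requires.\<close>

definition bump :: "real \<Rightarrow> real \<Rightarrow> nat \<Rightarrow> real \<Rightarrow> real" where
  "bump c d n x = flat_exp 1 (real (Suc n) * (x - c)) * flat_exp 1 (real (Suc n) * (d - x))"

lemma bump_pos: "c < x \<Longrightarrow> x < d \<Longrightarrow> bump c d n x > 0"
  by (simp add: bump_def flat_exp_def mult_less_0_iff not_le zero_less_mult_iff)

lemma bump_eq_0: "x \<notin> {c<..<d} \<Longrightarrow> bump c d n x = 0"
  by (auto simp: bump_def flat_exp_def not_less mult_le_0_iff)

lemma bump_nonneg: "bump c d n x \<ge> 0"
  by (auto simp: bump_def flat_exp_def)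

lemma bump_le_1: "bump c d n x \<le> 1"
proof -
  have "flat_exp 1 y \<in> {0..1}" for y by (auto simp: flat_exp_def)
  then show ?thesis by (auto simp: bump_def intro!: mult_le_one)
qed

lemma bump_tendsto: "(\<lambda>n. bump c d n x) \<longlonglongrightarrow> indicator {c<..<d} x"
proof (cases "x \<in> {c<..<d}")
  case True
  have *: "(\<lambda>n. exp (- (1 / (real (Suc n) * y)))) \<longlonglongrightarrow> 1" for y
  proof -
    have "(\<lambda>n. exp (- (1 / real (Suc n) * (1 / y)))) \<longlonglongrightarrow> exp (- (0 * (1 / y)))"
      using LIMSEQ_Suc[OF lim_1_over_n] by (intro tendsto_intros) simp
    then show ?thesis by simp
  qed
  have "bump c d n x = exp (- (1 / (real (Suc n) * (x - c)))) * exp (- (1 / (real (Suc n) * (d - x))))" for n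
    using True by (simp add: bump_def flat_exp_def mult_le_0_iff)
  moreover have "(\<lambda>n. exp (- (1 / (real (Suc n) * (x - c)))) * exp (- (1 / (real (Suc n) * (d - x))))) \<longlonglongrightarrow> 1 * 1"
    by (intro tendsto_mult *)
  ultimately show ?thesis using True by simp
qed (use bump_eq_0 in \<open>simp add: bump_eq_0\<close>)

lemma smooth_bump: "smooth (\<lambda>x. of_real (bump c d n x))"
proof -
  have "smooth (\<lambda>x. of_real (flat_exp 1 (real (Suc n) * x + - real (Suc n) * c)) * 
     of_real (flat_exp 1 (- real (Suc n) * x + real (Suc n) * d)))"
    by (intro smooth_mult smooth_affine[OF smooth_flat_exp])
  then show ?thesis by (simp add: bump_def algebra_simps)
qed

text \<open>Any compact set carrying the function may stand in for the closure of its support, which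
  makes sums and derivatives easy to handle.\<close>

lemma test_function_iff: "test_function J \<phi> \<longleftrightarrow> smooth \<phi> \<and> (\<exists>K. compact K \<and> K \<subseteq> J \<and> (\<forall>x. x \<notin> K \<longrightarrow> \<phi> x = 0))"
proof -
  have "compact (closure {x. \<phi> x \<noteq> 0}) \<and> closure {x. \<phi> x \<noteq> 0} \<subseteq> J" if "compact K" "K \<subseteq> J" "\<forall>x. x \<notin> K \<longrightarrow> \<phi> x = 0" for K
  proof -
    have "{x. \<phi> x \<noteq> 0} \<subseteq> K" using that(3) by blast
    then have "closure {x. \<phi> x \<noteq> 0} \<subseteq> K" using that(1) by (simp add: closure_minimal compact_imp_closed)
    moreover from this have "compact (closure {x. \<phi> x \<noteq> 0})"
      using compact_Int_closed[OF that(1) closed_closure, of "{x. \<phi> x \<noteq> 0}"] by (simp only: Int_absorb1)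
    ultimately show ?thesis using that(2) by blast
  qed
  moreover have "\<forall>x. x \<notin> closure {x. \<phi> x \<noteq> 0} \<longrightarrow> \<phi> x = 0"
    using closure_subset[of "{x. \<phi> x \<noteq> 0}"] by blast
  ultimately show ?thesis
    unfolding test_function_def smooth_def by (intro iffI) blast+
qed

lemma test_function_bump: "{c..d} \<subseteq> J \<Longrightarrow> test_function J (\<lambda>x. of_real (bump c d n x))"
  unfolding test_function_iff using smooth_bump by (auto intro!: exI[of _ "{c..d}"] bump_eq_0)

lemma test_function_add: "test_function J \<phi> \<Longrightarrow> test_function J \<psi> \<Longrightarrow> test_function J (\<lambda>x. \<phi> x + \<psi> x)"
  unfolding test_function_iff
proof (elim conjE exE, intro conjI)
  fix K L assume "compact K" "compact L" "K \<subseteq> J" "L \<subseteq> J" "\<forall>x. x \<notin> K \<longrightarrow> \<phi> x = 0" "\<forall>x. x \<notin> L \<longrightarrow> \<psi> x = 0"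
  then show "\<exists>K. compact K \<and> K \<subseteq> J \<and> (\<forall>x. x \<notin> K \<longrightarrow> \<phi> x + \<psi> x = 0)"
    by (intro exI[of _ "K \<union> L"]) auto
qed (rule smooth_add)

lemma test_function_cmult: "test_function J \<phi> \<Longrightarrow> test_function J (\<lambda>x. c * \<phi> x)"
  unfolding test_function_iff by (auto intro!: smooth_mult smooth_const)

lemma test_function_deriv:
  assumes "test_function J \<phi>"
  shows "test_function J (\<lambda>x. vector_derivative \<phi> (at x))"
    "(\<phi> has_vector_derivative vector_derivative \<phi> (at x)) (at x)"
proof -
  obtain K where K: "smooth \<phi>" "compact K" "K \<subseteq> J" "\<And>x. x \<notin> K \<Longrightarrow> \<phi> x = 0"
    using assms by (auto simp: test_function_iff)
  obtain \<phi>' where d: "smooth \<phi>'" "\<And>x. (\<phi> has_vector_derivative \<phi>' x) (at x)"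
    using smooth_cases[OF K(1)] by blast
  have eq: "vector_derivative \<phi> (at x) = \<phi>' x" for x using d by (simp add: vector_derivative_at)
  have "\<phi>' x = 0" if "x \<notin> K" for x
  proof -
    have "((\<lambda>x. 0) has_vector_derivative 0) (at x)" by simp
    then have "(\<phi> has_vector_derivative 0) (at x)"
      by (rule has_vector_derivative_transform_within_open[of _ _ _ "- K"])
       (use K that compact_imp_closed in \<open>auto simp: open_Compl\<close>)
    then show ?thesis using d(2) vector_derivative_unique_at by blast
  qed
  then show "test_function J (\<lambda>x. vector_derivative \<phi> (at x))"
    unfolding test_function_iff eq using d K by blast
  show "(\<phi> has_vector_derivative vector_derivative \<phi> (at x)) (at x)" using d eq by simp
qed

section \<open>Weak derivatives\<close>

text \<open>Once \<open>k\<close> is cut off to the interval, its integrals over half-lines vanish;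
  a pi-lambda argument extends this to Borel sets, a null set correction to Lebesgue sets, and a
  function whose integral over every set is 0 vanishes almost everywhere.\<close>

lemma AE_eq_0_if_primitive_eq_0:
  fixes k :: "real \<Rightarrow> complex"
  assumes k: "k absolutely_integrable_on {a..b}"
    and zero: "\<And>x. x \<in> {a..b} \<Longrightarrow> integral {a..x} k = 0"
  shows "AE x in lebesgue. x \<in> {a..b} \<longrightarrow> k x = 0"
proof -
  define h where "h x = indicator {a..b} x *\<^sub>R k x" for x
  have h: "integrable lebesgue h" using k by (simp add: h_def[abs_def] set_integrable_def)
  have hA: "set_integrable lebesgue A h" if "A \<in> sets lebesgue" for A
    unfolding set_integrable_def by (rule integrable_mult_indicator[OF that h])
  have atMost: "(LINT x:{..y}|lebesgue. h x) = 0" for y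
  proof -
    have "(LINT x:{..y}|lebesgue. h x) = (LINT x:{a..min b y}|lebesgue. k x)"
      unfolding set_lebesgue_integral_def h_def
      by (intro Bochner_Integration.integral_cong) (auto simp: indicator_def)
    also have "\<dots> = integral {a..min b y} k"
      by (intro set_lebesgue_integral_eq_integral absolutely_integrable_on_subinterval[OF k]) auto
    also have "\<dots> = 0" using zero[of "min b y"] by (cases "a \<le> min b y") auto
    finally show ?thesis .
  qed
  \<comment> \<open>The half-line up to \<open>b\<close> already carries all of \<open>h\<close>;
    the complement step of the induction over sets needs this total.\<close>
  have whole: "(LINT x:UNIV|lebesgue. h x) = 0"
  proof -
    have "(LINT x:UNIV|lebesgue. h x) = (LINT x:{..b}|lebesgue. h x)"
      unfolding set_lebesgue_integral_def h_def
      by (intro Bochner_Integration.integral_cong) (auto simp: indicator_def)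
    then show ?thesis using atMost by simp
  qed
  have "A \<in> sets borel \<and> (LINT x:A|lebesgue. h x) = 0" if "A \<in> sigma_sets UNIV (range (\<lambda>y::real. {..y}))" for A
  proof (rule sigma_sets_induct_disjoint[OF _ _ that])
    show "Int_stable (range (\<lambda>y::real. {..y}))"
      by (auto simp: Int_stable_def intro!: image_eqI[where x="min _ _"])
    fix A :: "real set" assume "A \<in> sigma_sets UNIV (range (\<lambda>y::real. {..y}))"
      and A: "A \<in> sets borel \<and> (LINT x:A|lebesgue. h x) = 0"
    then have "(LINT x:A \<union> (UNIV - A)|lebesgue. h x) = (LINT x:A|lebesgue. h x) + (LINT x:UNIV - A|lebesgue. h x)"
      by (intro set_integral_Un hA) auto
    moreover have "UNIV - A \<in> sets borel" using A sets.compl_sets[of A borel] by simp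
    ultimately show "UNIV - A \<in> sets borel \<and> (LINT x:UNIV - A|lebesgue. h x) = 0" using whole A by simp
  next
    fix A :: "nat \<Rightarrow> real set" assume d: "disjoint_family A"
      and A: "\<And>i. A i \<in> sets borel \<and> (LINT x:A i|lebesgue. h x) = 0"
    then have "(LINT x:(\<Union>i. A i)|lebesgue. h x) = (\<Sum>i. (LINT x:(A i)|lebesgue. h x))"
      by (intro lebesgue_integral_countable_add hA sets.countable_UN) (auto simp: disjoint_family_on_def)
    then show "\<Union> (range A) \<in> sets borel \<and> (LINT x:\<Union> (range A)|lebesgue. h x) = 0"
      using A by auto
  qed (use atMost in \<open>auto simp: set_lebesgue_integral_def\<close>)
  then have borel0: "(LINT x:A|lebesgue. h x) = 0" if "A \<in> sets lborel" for A
    using that by (simp add: borel_eq_atMost)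
  have lebesgue0: "(LINT x:A|lebesgue. h x) = 0" if "A \<in> sets lebesgue" for A
  proof -
    from that obtain S N N' where A: "A = S \<union> N" "N \<subseteq> N'" "N' \<in> null_sets lborel" "S \<in> sets lborel"
      by (rule sets_completionE)
    have "AE x in lebesgue. x \<notin> N'"
      using A(3) AE_completion AE_not_in by blast
    then have "AE x in lebesgue. indicator A x *\<^sub>R h x = indicator S x *\<^sub>R h x"
      by eventually_elim (use A in \<open>auto simp: indicator_def\<close>)
    then have "(LINT x:A|lebesgue. h x) = (LINT x:S|lebesgue. h x)"
      unfolding set_lebesgue_integral_def
      using A that h by (intro integral_cong_AE borel_measurable_scaleR borel_measurable_indicator) auto
    then show ?thesis using borel0 A by simp
  qed
  interpret finite_measure "lebesgue_on {a..b}" by (rule finite_measure_lebesgue_on) auto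
  have "AE x in lebesgue_on {a..b}. k x = 0"
  proof (rule density_zero)
    show "integrable (lebesgue_on {a..b}) k" using k by (rule absolutely_integrable_imp_integrable) auto
    fix A assume "A \<in> sets (lebesgue_on {a..b})"
    then have "A \<in> sets lebesgue" by (auto simp: sets_restrict_space)
    moreover have "(LINT x:A|lebesgue_on {a..b}. k x) = (LINT x:A|lebesgue. h x)"
      unfolding set_lebesgue_integral_def h_def
      by (subst integral_restrict_space) (auto intro!: Bochner_Integration.integral_cong simp: indicator_def)
    ultimately show "(LINT x:A|lebesgue_on {a..b}. k x) = 0" using lebesgue0 by simp
  qed
  then show ?thesis by (subst (asm) AE_restrict_space_iff) auto
qed

section \<open>Square-integrable functions on a bounded interval\<close>

abbreviation Ioo_measure :: "real \<Rightarrow> real \<Rightarrow> real measure" where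
  "Ioo_measure a b \<equiv> lebesgue_on {a<..<b}"

lemma square_integrable_on_iff_L2:
  "square_integrable_on g {a<..<b} \<longleftrightarrow> g \<in> L2 (Ioo_measure a b)"
  by (simp add: square_integrable_on_def L2_def set_borel_measurable_def set_integrable_def
      borel_measurable_restrict_space_iff integrable_restrict_space)

lemma set_lebesgue_integral_Ioo:
  fixes f :: "real \<Rightarrow> 'a :: {banach, second_countable_topology}"
  shows "(LINT x:{a<..<b}|lebesgue. f x) = (LINT x|Ioo_measure a b. f x)"
  by (simp add: set_lebesgue_integral_def integral_restrict_space)

text \<open>A bridge between two settings: the Sobolev notions integrate over the open interval,
  primitives live on the closed one, and the endpoints are null.\<close>

lemma integrable_Ioo_iff:
  fixes f :: "real \<Rightarrow> complex"
  shows "integrable (Ioo_measure a b) f \<longleftrightarrow> f absolutely_integrable_on {a..b}"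
  unfolding absolutely_integrable_on_Icc_iff_Ioo
  by (simp add: set_integrable_def integrable_restrict_space)

lemma integral_Ioo:
  fixes f :: "real \<Rightarrow> 'a :: euclidean_space"
  assumes "f absolutely_integrable_on {a..b}"
  shows "(LINT x|Ioo_measure a b. f x) = integral {a..b} f"
proof -
  have "f absolutely_integrable_on {a<..<b}"
    using assms by (simp add: absolutely_integrable_on_Icc_iff_Ioo)
  then have "(LINT x:{a<..<b}|lebesgue. f x) = integral {a<..<b} f"
    by (rule set_lebesgue_integral_eq_integral)
  then show ?thesis by (simp add: set_lebesgue_integral_Ioo integral_open_interval_real)
qed

lemma AE_Ioo_iff: "(AE x in Ioo_measure a b. P x) \<longleftrightarrow> (AE x in lebesgue. a < x \<and> x < b \<longrightarrow> P x)"
  by (subst AE_restrict_space_iff) auto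

lemma continuous_on_Icc_measurable:
  fixes f :: "real \<Rightarrow> complex"
  assumes "continuous_on {a..b} f"
  shows "f \<in> borel_measurable (Ioo_measure a b)"
  using assms by (intro continuous_imp_measurable_on_sets_lebesgue)
    (auto intro: continuous_on_subset)

lemma continuous_on_Icc_bounded:
  fixes f :: "real \<Rightarrow> complex"
  assumes "continuous_on {a..b} f"
  obtains B where "B \<ge> 0" "\<And>x. x \<in> {a..b} \<Longrightarrow> cmod (f x) \<le> B"
proof -
  have "bounded (f ` {a..b})"
    using assms by (intro compact_imp_bounded compact_continuous_image) auto
  then obtain B where "B > 0" "\<forall>x\<in>f ` {a..b}. cmod x \<le> B" unfolding bounded_pos by blast
  then show ?thesis by (intro that[of B]) auto
qed

lemma finite_measure_Ioo: "finite_measure (Ioo_measure a b)"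
  by (rule finite_measure_lebesgue_on) auto

lemma L2_continuous_mult:
  assumes "continuous_on {a..b} f" "g \<in> L2 (Ioo_measure a b)"
  shows "(\<lambda>x. f x * g x) \<in> L2 (Ioo_measure a b)"
proof -
  obtain B where B: "B \<ge> 0" "\<And>x. x \<in> {a..b} \<Longrightarrow> cmod (f x) \<le> B"
    using continuous_on_Icc_bounded[OF assms(1)] by blast
  have [measurable]: "f \<in> borel_measurable (Ioo_measure a b)" "g \<in> borel_measurable (Ioo_measure a b)"
    using assms continuous_on_Icc_measurable by (auto simp: L2_def)
  have "integrable (Ioo_measure a b) (\<lambda>x. (cmod (f x * g x))\<^sup>2)"
  proof (rule Bochner_Integration.integrable_bound)
    show "integrable (Ioo_measure a b) (\<lambda>x. B\<^sup>2 * (cmod (g x))\<^sup>2)"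
      using assms by (simp add: L2_integrable)
    show "AE x in Ioo_measure a b. norm ((cmod (f x * g x))\<^sup>2) \<le> norm (B\<^sup>2 * (cmod (g x))\<^sup>2)"
      using B by (intro AE_I2) (auto simp: norm_mult power_mult_distrib intro!: mult_right_mono power_mono)
  qed simp
  then show ?thesis by (simp add: L2_def)
qed

lemma L2_const: "(\<lambda>x. c) \<in> L2 (Ioo_measure a b)"
proof -
  interpret finite_measure "Ioo_measure a b" by (rule finite_measure_Ioo)
  show ?thesis by (simp add: L2_def)
qed

lemma L2_continuous:
  assumes "continuous_on {a..b} f"
  shows "f \<in> L2 (Ioo_measure a b)"
  using L2_continuous_mult[OF assms L2_const[of 1]] by simp

lemma L2_imp_absolutely_integrable:
  assumes "g \<in> L2 (Ioo_measure a b)"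
  shows "g absolutely_integrable_on {a..b}"
  using L2_integrable_mult[OF assms L2_const[of 1]] by (simp add: integrable_Ioo_iff)

lemma L2_mult_absolutely_integrable:
  assumes "f \<in> L2 (Ioo_measure a b)" "g \<in> L2 (Ioo_measure a b)"
  shows "(\<lambda>x. f x * g x) absolutely_integrable_on {a..b}"
  using L2_integrable_mult[OF assms] by (simp add: integrable_Ioo_iff)

text \<open>Cauchy-Schwarz against the indicator of \<open>{a..x}\<close>. It bounds a function that
  vanishes at \<open>a\<close>, uniformly, by the mean square of its derivative.\<close>

lemma primitive_sq_le:
  assumes g: "g \<in> L2 (Ioo_measure a b)" and x: "x \<in> {a..b}"
  shows "(cmod (integral {a..x} g))\<^sup>2 \<le> (b - a) * sqnorm (Ioo_measure a b) g"
proof -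
  define u where "u t = (if t \<le> x then 1 else 0 :: complex)" for t
  interpret finite_measure "Ioo_measure a b" by (rule finite_measure_Ioo)
  have um: "u \<in> borel_measurable (Ioo_measure a b)"
  proof -
    have "u \<in> borel_measurable borel" unfolding u_def by measurable
    then have "u \<in> borel_measurable lebesgue" by (intro measurable_completion) simp
    then show ?thesis by (rule measurable_restrict_space1)
  qed
  have u: "u \<in> L2 (Ioo_measure a b)"
  proof -
    have "integrable (Ioo_measure a b) (\<lambda>x. (cmod (u x))\<^sup>2)"
    proof (rule integrable_const_bound[of _ 1])
      show "AE x in Ioo_measure a b. norm ((cmod (u x))\<^sup>2) \<le> 1" by (auto simp: u_def)
      show "(\<lambda>x. (cmod (u x))\<^sup>2) \<in> borel_measurable (Ioo_measure a b)" using um by measurable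
    qed
    then show ?thesis using um by (simp add: L2_def)
  qed
  have "sqnorm (Ioo_measure a b) u \<le> (LINT x|Ioo_measure a b. 1)"
    unfolding sqnorm_def by (intro integral_mono L2_integrable[OF u]) (auto simp: u_def)
  also have "\<dots> = b - a" using x by (simp add: measure_restrict_space)
  finally have un: "sqnorm (Ioo_measure a b) u \<le> b - a" .
  have "(LINT t|Ioo_measure a b. u t * g t) = integral {a..b} (\<lambda>t. u t * g t)"
    by (rule integral_Ioo[OF L2_mult_absolutely_integrable[OF u g]])
  also have "\<dots> = integral {a..b} (\<lambda>t. if t \<in> {a..x} then g t else 0)"
    by (intro integral_cong) (auto simp: u_def)
  also have "\<dots> = integral {a..x} g"
    using x by (subst Henstock_Kurzweil_Integration.integral_restrict_Int) (simp add: Int_absorb1)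
  finally have "(cmod (integral {a..x} g))\<^sup>2 \<le> sqnorm (Ioo_measure a b) u * sqnorm (Ioo_measure a b) g"
    using L2_Cauchy_Schwarz[OF u g] by simp
  also have "\<dots> \<le> (b - a) * sqnorm (Ioo_measure a b) g"
    using un by (intro mult_right_mono) auto
  finally show ?thesis .
qed

section \<open>Testing against smooth functions\<close>

lemma test_function_cont_deriv:
  assumes "test_function J \<phi>"
  shows "continuous_on S \<phi>" "continuous_on S (\<lambda>x. vector_derivative \<phi> (at x))"
  using test_function_deriv[OF assms] test_function_deriv(2)[OF test_function_deriv(1)[OF assms]]
  by (meson continuous_at_imp_continuous_on has_vector_derivative_continuous)+

lemma test_function_zero: "test_function J \<phi> \<Longrightarrow> x \<notin> J \<Longrightarrow> \<phi> x = 0"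
  unfolding test_function_iff by auto

lemma test_function_has_ac_derivative:
  assumes "test_function J \<phi>"
  shows "has_ac_derivative \<phi> (\<lambda>x. vector_derivative \<phi> (at x)) a b"
  by (rule has_ac_derivative_C1[OF has_vector_derivative_at_within[OF test_function_deriv(2)[OF assms]]
     test_function_cont_deriv(2)[OF assms]])

text \<open>The bumps converge boundedly to the indicator of any inner interval, so the primitive of
  \<open>k\<close> has no increments there; continuity carries this to the endpoints, and the
  density of a zero primitive vanishes almost everywhere.\<close>

lemma fundamental_lemma:
  assumes k: "k \<in> L2 (Ioo_measure a b)"
    and zero: "\<And>\<phi>. test_function {a<..<b} \<phi> \<Longrightarrow> (LINT x|Ioo_measure a b. k x * \<phi> x) = 0"
  shows "AE x in Ioo_measure a b. k x = 0"
proof -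
  have ki: "k absolutely_integrable_on {a..b}" by (rule L2_imp_absolutely_integrable[OF k])
  define F where "F x = integral {a..x} k" for x
  have contF: "continuous_on {a..b} F" unfolding F_def
    by (rule indefinite_integral_continuous_1[OF set_lebesgue_integral_eq_integral(1)[OF ki]])
  have eqF: "F c = F d" if "a < c" "c < d" "d < b" for c d
  proof -
    have sub: "k absolutely_integrable_on {c..d}"
      by (rule absolutely_integrable_on_subinterval[OF ki]) (use that in auto)
    have "(\<lambda>n. LINT x|Ioo_measure a b. k x * of_real (bump c d n x)) \<longlonglongrightarrow> (LINT x|Ioo_measure a b. k x * indicator {c<..<d} x)"
    proof (rule integral_dominated_convergence)
      show "integrable (Ioo_measure a b) (\<lambda>x. cmod (k x))"
        using ki by (simp add: integrable_Ioo_iff[symmetric])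
      have [measurable]: "k \<in> borel_measurable (Ioo_measure a b)" using k by (auto simp: L2_def)
      have [measurable]: "(\<lambda>x. of_real (bump c d n x) :: complex) \<in> borel_measurable (Ioo_measure a b)" for n
        using that by (intro continuous_on_Icc_measurable test_function_cont_deriv(1)[OF test_function_bump[of c d "UNIV"]]) auto
      show "(\<lambda>x. k x * of_real (bump c d n x)) \<in> borel_measurable (Ioo_measure a b)" for n by measurable
      show "AE x in Ioo_measure a b. (\<lambda>n. k x * of_real (bump c d n x)) \<longlonglongrightarrow> k x * indicator {c<..<d} x"
      proof (intro AE_I2 tendsto_mult tendsto_const)
        fix x
        have "(\<lambda>n. complex_of_real (bump c d n x)) \<longlonglongrightarrow> of_real (indicator {c<..<d} x)"
          by (intro tendsto_of_real bump_tendsto)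
        then show "(\<lambda>n. complex_of_real (bump c d n x)) \<longlonglongrightarrow> indicator {c<..<d} x"
          by (cases "x \<in> {c<..<d}") (simp_all only: indicator_simps of_real_0 of_real_1 not_False_eq_True)
      qed
      show "AE x in Ioo_measure a b. norm (k x * of_real (bump c d n x)) \<le> cmod (k x)" for n
        using bump_nonneg bump_le_1 by (intro AE_I2) (auto simp: norm_mult intro!: mult_left_le)
      have "(\<lambda>x. indicator {c<..<d} x :: complex) \<in> borel_measurable (Ioo_measure a b)"
        by (intro borel_measurable_indicator) (use that in \<open>auto simp: sets_restrict_space image_iff intro!: bexI[of _ "{c<..<d}"]\<close>)
      then show "(\<lambda>x. k x * indicator {c<..<d} x) \<in> borel_measurable (Ioo_measure a b)" by measurable
    qed
    moreover have "(LINT x|Ioo_measure a b. k x * of_real (bump c d n x)) = 0" for n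
      using that by (intro zero test_function_bump) auto
    ultimately have "(LINT x|Ioo_measure a b. k x * indicator {c<..<d} x) = 0"
      by (simp add: LIMSEQ_const_iff)
    moreover have "(LINT x|Ioo_measure a b. k x * indicator {c<..<d} x) = (LINT x|Ioo_measure c d. k x)"
      using that by (subst (1 2) integral_restrict_space)
        (auto intro!: Bochner_Integration.integral_cong simp: indicator_def)
    ultimately have "integral {c..d} k = 0" by (simp add: integral_Ioo[OF sub])
    moreover have "integral {a..c} k + integral {c..d} k = integral {a..d} k"
      using that by (intro Henstock_Kurzweil_Integration.integral_combine set_lebesgue_integral_eq_integral(1)
         absolutely_integrable_on_subinterval[OF ki]) auto
    ultimately show ?thesis by (simp add: F_def)
  qed
  have "F x = 0" if "x \<in> {a..b}" for x
  proof (cases "a < b")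
    case True
    have mid: "a < (a+b)/2" "(a+b)/2 < b" using True by auto
    have mid': "F y = F ((a+b)/2)" if "y \<in> {a<..<b}" for y
    proof (cases y "(a+b)/2" rule: linorder_cases)
      case less then show ?thesis using that mid by (intro eqF) auto
    next
      case greater then show ?thesis using that mid by (intro eqF[symmetric]) auto
    qed (simp only:)
    have cl: "F y = F ((a+b)/2)" if "y \<in> closure {a<..<b}" for y
    proof (rule continuous_constant_on_closure[OF _ _ that])
      show "continuous_on (closure {a<..<b}) F" using contF True by simp
    qed (rule mid')
    have "F x = F ((a+b)/2)" "F a = F ((a+b)/2)" using that True by (intro cl; simp)+
    moreover have "F a = 0" by (simp add: F_def)
    ultimately show ?thesis by simp
  next
    case False
    then have "x = a" using that by auto
    then show ?thesis by (simp add: F_def)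
  qed
  then have "AE x in lebesgue. x \<in> {a..b} \<longrightarrow> k x = 0"
    unfolding F_def by (intro AE_eq_0_if_primitive_eq_0[OF ki])
  then show ?thesis unfolding AE_Ioo_iff by eventually_elim auto
qed

text \<open>The primitive from \<open>a\<close> is zero to the left of the support, and to the right
  of it because the total integral vanishes.\<close>

lemma test_function_antiderivative:
  assumes ab: "a < b" and \<psi>: "test_function {a<..<b} \<psi>" and zero: "integral {a..b} \<psi> = 0"
  obtains \<phi> where "test_function {a<..<b} \<phi>" "\<And>x. vector_derivative \<phi> (at x) = \<psi> x"
proof -
  obtain K where K: "compact K" "K \<subseteq> {a<..<b}" "\<And>x. x \<notin> K \<Longrightarrow> \<psi> x = 0" and sm: "smooth \<psi>"
    using \<psi> by (auto simp: test_function_iff)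
  \<comment> \<open>The extreme points of \<open>K\<close>, which may coincide; the midpoint of the
    interval serves when \<open>K\<close> is empty.\<close>
  obtain c d where cd: "a < c" "d < b" "K \<subseteq> {c..d}" "c \<le> d"
  proof (cases "K = {}")
    case True
    then show ?thesis using that[of "(a+b)/2" "(a+b)/2"] ab by auto
  next
    case False
    obtain s where s: "s \<in> K" "\<And>y. y \<in> K \<Longrightarrow> s \<le> y"
      using compact_attains_inf[OF K(1) False] by blast
    obtain t where t: "t \<in> K" "\<And>y. y \<in> K \<Longrightarrow> y \<le> t"
      using compact_attains_sup[OF K(1) False] by blast
    show ?thesis using K(2) s t by (intro that[of s t]) auto
  qed
  have z: "\<psi> x = 0" if "x \<notin> {c..d}" for x using K(3) cd(3) that by blast
  have cont: "continuous_on S \<psi>" for S by (rule test_function_cont_deriv(1)[OF \<psi>])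
  define \<phi> where "\<phi> x = integral {a..x} \<psi>" for x
  have left: "\<phi> x = 0" if "x < c" for x
  proof -
    have "integral {a..x} \<psi> = integral {a..x} (\<lambda>x. 0)"
      using z that by (intro integral_cong) auto
    then show ?thesis by (simp add: \<phi>_def)
  qed
  have right: "\<phi> x = 0" if "x > d" for x
  proof -
    have "{t \<in> {a..x} - {a..b}. \<psi> t \<noteq> 0} = {}" "{t \<in> {a..b} - {a..x}. \<psi> t \<noteq> 0} = {}"
      using z that cd by fastforce+
    then have "integral {a..x} \<psi> = integral {a..b} \<psi>"
      by (intro integral_spike_set) (simp_all only: negligible_empty)
    then show ?thesis using zero by (simp add: \<phi>_def)
  qed
  \<comment> \<open>The derivative of the integral is available only to the right of
    \<open>a\<close>; at \<open>x \<le> a\<close> the function is zero on all of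
    \<open>{..<c}\<close>, a neighbourhood of \<open>x\<close>.\<close>
  have deriv: "(\<phi> has_vector_derivative \<psi> x) (at x)" for x
  proof (cases "x > a")
    case True
    have "(\<phi> has_vector_derivative \<psi> x) (at x within {a..x+1})"
      unfolding \<phi>_def using True by (intro integral_has_vector_derivative cont) auto
    moreover have "x \<in> interior {a..x+1}" using True by simp
    ultimately show ?thesis by (simp only: at_within_interior)
  next
    case False
    have "((\<lambda>x. 0) has_vector_derivative 0) (at x)" by simp
    then have "(\<phi> has_vector_derivative 0) (at x)"
      by (rule has_vector_derivative_transform_within_open[of _ _ _ "{..<c}"])
       (use False cd left in auto)
    then show ?thesis using z[of x] False cd by simp
  qed
  have "smooth \<phi>" using sm deriv by (rule smooth_antiderivative)
  moreover have "\<phi> x = 0" if "x \<notin> {c..d}" for x using left right that by fastforce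
  ultimately have "test_function {a<..<b} \<phi>"
    unfolding test_function_iff using cd by (intro conjI exI[of _ "{c..d}"]) auto
  then show ?thesis using deriv by (intro that) (auto simp: vector_derivative_at)
qed

lemma test_function_L2: "test_function J \<phi> \<Longrightarrow> \<phi> \<in> L2 (Ioo_measure a b)"
  by (rule L2_continuous[OF test_function_cont_deriv(1)])

lemma test_function_deriv_L2: "test_function J \<phi> \<Longrightarrow> (\<lambda>x. vector_derivative \<phi> (at x)) \<in> L2 (Ioo_measure a b)"
  by (rule L2_continuous[OF test_function_cont_deriv(2)])

text \<open>A test function minus its integral times \<open>\<rho>\<close>, a test function of
  integral 1, has integral 0 and so is a derivative. Testing \<open>k\<close> against it shows that
  \<open>k\<close> acts like the constant \<open>C\<close>, its pairing with
  \<open>\<rho>\<close>.\<close>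

lemma du_Bois_Reymond:
  assumes ab: "a < b" and k: "k \<in> L2 (Ioo_measure a b)"
    and zero: "\<And>\<phi>. test_function {a<..<b} \<phi> \<Longrightarrow> (LINT x|Ioo_measure a b. k x * vector_derivative \<phi> (at x)) = 0"
  obtains c where "AE x in Ioo_measure a b. k x = c"
proof -
  \<comment> \<open>The middle third keeps the support of \<open>\<rho>0\<close> inside the open
    interval.\<close>
  define c d where "c = (2 * a + b) / 3" and "d = (a + 2 * b) / 3"
  have cd: "a < c" "c < d" "d < b" using ab by (auto simp: c_def d_def field_simps)
  define \<rho>0 where "\<rho>0 x = complex_of_real (bump c d 0 x)" for x
  have t0: "test_function {a<..<b} \<rho>0" unfolding \<rho>0_def using cd by (intro test_function_bump) auto
  have r: "continuous_on {a..b} (bump c d 0)"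
    using continuous_on_Re[OF test_function_cont_deriv(1)[OF t0, of "{a..b}"]] by (simp add: \<rho>0_def)
  have "integral {a..b} (bump c d 0) \<noteq> 0"
    using bump_pos[of c "(c+d)/2" d 0] cd bump_nonneg
    by (subst integral_eq_0_iff[OF r ab]) (auto intro!: bexI[of _ "(c+d)/2"])
  moreover have "integral {a..b} \<rho>0 = of_real (integral {a..b} (bump c d 0))"
    unfolding \<rho>0_def using r
    by (intro integral_unique has_integral_of_real integrable_integral integrable_continuous_real)
  ultimately have I0: "integral {a..b} \<rho>0 \<noteq> 0" by simp
  define \<rho> where "\<rho> x = inverse (integral {a..b} \<rho>0) * \<rho>0 x" for x
  have \<rho>: "test_function {a<..<b} \<rho>" unfolding \<rho>_def by (rule test_function_cmult[OF t0])
  have I\<rho>: "integral {a..b} \<rho> = 1" unfolding \<rho>_def using I0 by simp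
  define C where "C = (LINT x|Ioo_measure a b. k x * \<rho> x)"
  have "AE x in Ioo_measure a b. k x - C = 0"
  proof (rule fundamental_lemma)
    show "(\<lambda>x. k x - C) \<in> L2 (Ioo_measure a b)" by (intro L2_diff k L2_const)
    fix \<psi> assume \<psi>: "test_function {a<..<b} \<psi>"
    have int: "f integrable_on {a..b}" if "test_function {a<..<b} f" for f
      by (rule integrable_continuous_real[OF test_function_cont_deriv(1)[OF that]])
    define I where "I = integral {a..b} \<psi>"
    have t: "test_function {a<..<b} (\<lambda>x. \<psi> x + (- I) * \<rho> x)"
      by (intro test_function_add test_function_cmult \<psi> \<rho>)
    have "integral {a..b} (\<lambda>x. \<psi> x + (- I) * \<rho> x) = integral {a..b} \<psi> + integral {a..b} (\<lambda>x. (- I) * \<rho> x)"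
      by (intro integral_add int \<psi> test_function_cmult \<rho>)
    also have "\<dots> = 0" using I\<rho> by (simp add: I_def)
    finally obtain \<phi> where \<phi>: "test_function {a<..<b} \<phi>" "\<And>x. vector_derivative \<phi> (at x) = \<psi> x + (- I) * \<rho> x"
      using test_function_antiderivative[OF ab t] by blast
    have i1: "integrable (Ioo_measure a b) (\<lambda>x. k x * \<psi> x)" and i2: "integrable (Ioo_measure a b) (\<lambda>x. k x * \<rho> x)"
      and i3: "integrable (Ioo_measure a b) \<psi>"
      using L2_integrable_mult[OF k test_function_L2[OF \<psi>]] L2_integrable_mult[OF k test_function_L2[OF \<rho>]]
        L2_integrable_mult[OF L2_const[of 1] test_function_L2[OF \<psi>]] by auto
    have I_eq: "(LINT x|Ioo_measure a b. \<psi> x) = I"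
      unfolding I_def using i3 by (intro integral_Ioo) (simp only: integrable_Ioo_iff)
    have "0 = (LINT x|Ioo_measure a b. k x * \<psi> x + (- I) * (k x * \<rho> x))"
      using zero[OF \<phi>(1)] by (simp add: \<phi>(2) algebra_simps)
    also have "\<dots> = (LINT x|Ioo_measure a b. k x * \<psi> x) + (- I) * C"
      unfolding C_def using i1 i2 by (subst Bochner_Integration.integral_add) auto
    also have "\<dots> = (LINT x|Ioo_measure a b. k x * \<psi> x) - (LINT x|Ioo_measure a b. C * \<psi> x)"
      by (simp add: I_eq mult.commute)
    also have "\<dots> = (LINT x|Ioo_measure a b. k x * \<psi> x - C * \<psi> x)"
      using i1 i3 by (subst Bochner_Integration.integral_diff) auto
    finally show "(LINT x|Ioo_measure a b. (k x - C) * \<psi> x) = 0" by (simp add: left_diff_distrib)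
  qed
  then show ?thesis using that[of C] by simp
qed

section \<open>Weak derivatives of absolutely continuous functions\<close>

lemma weak_derivative_unique:
  assumes "g \<in> L2 (Ioo_measure a b)" "h \<in> L2 (Ioo_measure a b)"
    and "has_weak_derivative_on y g {a<..<b}" "has_weak_derivative_on y h {a<..<b}"
  shows "AE x in Ioo_measure a b. g x = h x"
proof -
  have "AE x in Ioo_measure a b. g x - h x = 0"
  proof (rule fundamental_lemma)
    show "(\<lambda>x. g x - h x) \<in> L2 (Ioo_measure a b)" by (intro L2_diff assms)
    fix \<phi> assume \<phi>: "test_function {a<..<b} \<phi>"
    then have "(LINT x|Ioo_measure a b. g x * \<phi> x) = (LINT x|Ioo_measure a b. h x * \<phi> x)"
      using assms(3,4) by (simp add: has_weak_derivative_on_def set_lebesgue_integral_Ioo)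
    then show "(LINT x|Ioo_measure a b. (g x - h x) * \<phi> x) = 0"
      using L2_integrable_mult[OF assms(1) test_function_L2[OF \<phi>]] L2_integrable_mult[OF assms(2) test_function_L2[OF \<phi>]]
      by (simp add: left_diff_distrib)
  qed
  then show ?thesis by simp
qed

text \<open>Integration by parts; the boundary terms vanish with the test function.\<close>

lemma has_ac_derivative_weak:
  assumes y: "has_ac_derivative y h a b" and "a < b"
  shows "has_weak_derivative_on y h {a<..<b}"
  unfolding has_weak_derivative_on_def set_lebesgue_integral_Ioo
proof (intro allI impI)
  fix \<phi> assume \<phi>: "test_function {a<..<b} \<phi>"
  let ?d = "\<lambda>x. vector_derivative \<phi> (at x)"
  have ac: "has_ac_derivative (\<lambda>x. y x * \<phi> x) (\<lambda>x. h x * \<phi> x + y x * ?d x) a b"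
    by (rule has_ac_derivative_mult[OF y test_function_has_ac_derivative[OF \<phi>]])
  have z: "\<phi> a = 0" "\<phi> b = 0" using test_function_zero[OF \<phi>] by auto
  have i1: "(\<lambda>x. h x * \<phi> x) absolutely_integrable_on {a..b}"
    using absolutely_integrable_on_Icc_mult_continuous[OF has_ac_derivativeD(1)[OF y] test_function_cont_deriv(1)[OF \<phi>]]
    by (simp add: mult.commute)
  have i2: "(\<lambda>x. y x * ?d x) absolutely_integrable_on {a..b}"
    by (intro absolutely_integrable_continuous_real continuous_on_mult has_ac_derivative_continuous_on[OF y]
       test_function_cont_deriv(2)[OF \<phi>])
  have "y b * \<phi> b = y a * \<phi> a + integral {a..b} (\<lambda>x. h x * \<phi> x + y x * ?d x)"
    using has_ac_derivativeD(2)[OF ac, of b] \<open>a < b\<close> by simp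
  then have "integral {a..b} (\<lambda>x. h x * \<phi> x) + integral {a..b} (\<lambda>x. y x * ?d x) = 0"
    using z integral_add[OF set_lebesgue_integral_eq_integral(1)[OF i1] set_lebesgue_integral_eq_integral(1)[OF i2]] by simp
  then show "(LINT x|Ioo_measure a b. y x * ?d x) = - (LINT x|Ioo_measure a b. h x * \<phi> x)"
    by (simp add: integral_Ioo i1 i2 eq_neg_iff_add_eq_0 add.commute)
qed

lemma weak_deriv_W12:
  assumes "y \<in> W12 {a<..<b}"
  shows "weak_deriv {a<..<b} y \<in> L2 (Ioo_measure a b)" "has_weak_derivative_on y (weak_deriv {a<..<b} y) {a<..<b}"
proof -
  have "\<exists>g. square_integrable_on g {a<..<b} \<and> has_weak_derivative_on y g {a<..<b}"
    using assms by (auto simp: W12_def)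
  from someI_ex[OF this] show "weak_deriv {a<..<b} y \<in> L2 (Ioo_measure a b)" "has_weak_derivative_on y (weak_deriv {a<..<b} y) {a<..<b}"
    by (auto simp: weak_deriv_def square_integrable_on_iff_L2)
qed

text \<open>Uniqueness of weak derivatives ties the arbitrary choice made by
  \<open>weak_deriv\<close> to the concrete density \<open>h\<close>, so that norms and pairings can
  be computed with \<open>h\<close>.\<close>

lemma has_ac_derivative_W12:
  assumes y: "has_ac_derivative y h a b" and h: "h \<in> L2 (Ioo_measure a b)" and ab: "a < b"
  shows "y \<in> W12 {a<..<b}" "AE x in Ioo_measure a b. weak_deriv {a<..<b} y x = h x"
proof -
  have c: "continuous_on {a..b} y" by (rule has_ac_derivative_continuous_on[OF y])
  show "y \<in> W12 {a<..<b}"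
    using c L2_continuous[OF c] h has_ac_derivative_weak[OF y ab] ab
    by (auto simp: W12_def square_integrable_on_iff_L2)
  from weak_derivative_unique[OF weak_deriv_W12(1)[OF this] h weak_deriv_W12(2)[OF this] has_ac_derivative_weak[OF y ab]]
  show "AE x in Ioo_measure a b. weak_deriv {a<..<b} y x = h x" .
qed

lemma sqnorm_cong_AE:
  assumes "AE x in M. f x = g x" "f \<in> borel_measurable M" "g \<in> borel_measurable M"
  shows "sqnorm M f = sqnorm M g"
  unfolding sqnorm_def using assms by (intro integral_cong_AE) (auto elim: eventually_mono)

lemma W12_norm_eq:
  "W12_norm {a<..<b} y = sqrt (sqnorm (Ioo_measure a b) y + sqnorm (Ioo_measure a b) (weak_deriv {a<..<b} y))"
  by (simp add: W12_norm_def sqnorm_def set_lebesgue_integral_Ioo)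

lemma sqnorm_le_sup:
  assumes "continuous_on {a..b} y" "a \<le> b" "\<And>x. x \<in> {a..b} \<Longrightarrow> (cmod (y x))\<^sup>2 \<le> B"
  shows "sqnorm (Ioo_measure a b) y \<le> (b - a) * B"
proof -
  interpret finite_measure "Ioo_measure a b" by (rule finite_measure_Ioo)
  have "sqnorm (Ioo_measure a b) y \<le> (LINT x|Ioo_measure a b. B)"
    unfolding sqnorm_def using L2_continuous[OF assms(1)] assms by (intro integral_mono) (auto simp: L2_integrable)
  then show ?thesis using assms(2) by (simp add: measure_restrict_space)
qed

text \<open>Poincare's inequality: the zero at \<open>a\<close> lets \<open>primitive_sq_le\<close>
  control the function itself, with one factor \<open>b - a\<close> from the uniform bound and one
  from the length of the interval.\<close>

lemma W12_norm_le:
  assumes y: "has_ac_derivative y h a b" and h: "h \<in> L2 (Ioo_measure a b)" and ab: "a < b" and ya: "y a = 0"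
  shows "(W12_norm {a<..<b} y)\<^sup>2 \<le> (1 + (b - a)\<^sup>2) * sqnorm (Ioo_measure a b) h"
proof -
  let ?M = "Ioo_measure a b"
  have "(cmod (y x))\<^sup>2 \<le> (b - a) * sqnorm ?M h" if "x \<in> {a..b}" for x
    using primitive_sq_le[OF h that] has_ac_derivativeD(2)[OF y that] ya by simp
  then have "sqnorm ?M y \<le> (b - a) * ((b - a) * sqnorm ?M h)"
    using ab by (intro sqnorm_le_sup has_ac_derivative_continuous_on[OF y]) auto
  moreover have "sqnorm ?M (weak_deriv {a<..<b} y) = sqnorm ?M h"
    using has_ac_derivative_W12[OF y h ab] weak_deriv_W12(1) h by (intro sqnorm_cong_AE) (auto simp: L2_def)
  ultimately show ?thesis by (simp add: W12_norm_eq power2_eq_square algebra_simps)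
qed

section \<open>The Sobolev space with zero boundary values and its dual\<close>

lemma vector_derivative_test_function_add:
  assumes "test_function J \<phi>" "test_function J \<psi>"
  shows "vector_derivative (\<lambda>x. \<phi> x + \<psi> x) (at x) = vector_derivative \<phi> (at x) + vector_derivative \<psi> (at x)"
  by (intro vector_derivative_at has_vector_derivative_add test_function_deriv(2)[OF assms(1)] test_function_deriv(2)[OF assms(2)])

lemma vector_derivative_test_function_cmult:
  assumes "test_function J \<phi>"
  shows "vector_derivative (\<lambda>x. c * \<phi> x) (at x) = c * vector_derivative \<phi> (at x)"
  by (intro vector_derivative_at has_vector_derivative_mult_right test_function_deriv(2)[OF assms])

lemma sqnorm_minus_commute: "sqnorm M (\<lambda>x. f x - g x) = sqnorm M (\<lambda>x. g x - f x)"
  by (simp add: sqnorm_def norm_minus_commute)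

text \<open>The functional \<open>\<phi> \<mapsto> \<integral> cnj h * \<phi>'\<close> on test functions is represented by a limit \<open>k\<close> of
  derivatives of test functions. By du Bois-Reymond \<open>k - h\<close> is constant, and it has mean zero.\<close>

lemma has_ac_derivative_W12_0:
  assumes y: "has_ac_derivative y h a b" and h: "h \<in> L2 (Ioo_measure a b)" and ab: "a < b"
    and zero: "y a = 0" "y b = 0"
  shows "y \<in> W12_0 {a<..<b}"
proof -
  let ?M = "Ioo_measure a b" and ?J = "{a<..<b}"
  define T where "T \<phi> x = vector_derivative \<phi> (at x)" for \<phi> :: "real \<Rightarrow> complex" and x
  define l where "l \<phi> = (LINT x|?M. cnj (h x) * T \<phi> x)" for \<phi>
  have TL: "T \<phi> \<in> L2 ?M" if "test_function ?J \<phi>" for \<phi>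
    unfolding T_def by (rule test_function_deriv_L2[OF that])
  have Tadd: "T (\<lambda>x. \<phi> x + \<psi> x) = (\<lambda>x. T \<phi> x + T \<psi> x)" if "test_function ?J \<phi>" "test_function ?J \<psi>" for \<phi> \<psi>
    unfolding T_def by (intro ext vector_derivative_test_function_add[OF that])
  have Tmult: "T (\<lambda>x. c * \<phi> x) = (\<lambda>x. c * T \<phi> x)" if "test_function ?J \<phi>" for c \<phi>
    unfolding T_def by (intro ext vector_derivative_test_function_cmult[OF that])
  have int: "integrable ?M (\<lambda>x. cnj (h x) * T \<phi> x)" if "test_function ?J \<phi>" for \<phi>
    by (intro L2_integrable_mult L2_cnj h TL that)
  have t0: "test_function ?J (\<lambda>x. 0)"
    unfolding test_function_iff by (intro conjI smooth_const exI[of _ "{}"]) auto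
  obtain k v where k: "k \<in> L2 ?M" and v: "\<And>n. v n \<in> {\<phi>. test_function ?J \<phi>}"
    and lim: "(\<lambda>n. sqnorm ?M (\<lambda>x. T (v n) x - k x)) \<longlonglongrightarrow> 0"
    and lk: "\<And>\<phi>. \<phi> \<in> {\<phi>. test_function ?J \<phi>} \<Longrightarrow> l \<phi> = (LINT x|?M. cnj (k x) * T \<phi> x)"
  \<comment> \<open>Here \<open>V\<close> consists of test functions and \<open>T\<close>
    differentiates them, so the \<open>v n\<close> that come with the representation are the
    approximating test functions sought.\<close>
  proof (rule L2_Riesz[of "\<lambda>x. 0" "{\<phi>. test_function ?J \<phi>}" T ?M l "sqnorm ?M h"])
    fix \<phi> \<psi> c assume "\<phi> \<in> {\<phi>. test_function ?J \<phi>}"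
    then have \<phi>: "test_function ?J \<phi>" by simp
    show "l (\<lambda>x. c * \<phi> x) = c * l \<phi>" 
      unfolding l_def Tmult[OF \<phi>] by (simp add: mult.left_commute)
    have "(cmod (l \<phi>))\<^sup>2 \<le> sqnorm ?M (\<lambda>x. cnj (h x)) * sqnorm ?M (T \<phi>)"
      unfolding l_def by (intro L2_Cauchy_Schwarz L2_cnj h TL \<phi>)
    then show "(cmod (l \<phi>))\<^sup>2 \<le> sqnorm ?M h * sqnorm ?M (T \<phi>)" by (simp add: sqnorm_def)
    assume "\<psi> \<in> {\<phi>. test_function ?J \<phi>}"
    then have \<psi>: "test_function ?J \<psi>" by simp
    show "l (\<lambda>x. \<phi> x + \<psi> x) = l \<phi> + l \<psi>" 
      unfolding l_def Tadd[OF \<phi> \<psi>] using int[OF \<phi>] int[OF \<psi>] by (simp add: distrib_left)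
  qed (auto simp: TL Tadd Tmult t0 intro: test_function_add test_function_cmult)
  have tv: "test_function ?J (v n)" for n using v by simp
  obtain c where c: "AE x in ?M. cnj (k x) - cnj (h x) = c"
  proof (rule du_Bois_Reymond[OF ab])
    show "(\<lambda>x. cnj (k x) - cnj (h x)) \<in> L2 ?M" by (intro L2_diff L2_cnj h k)
    fix \<phi> assume \<phi>: "test_function ?J \<phi>"
    show "(LINT x|?M. (cnj (k x) - cnj (h x)) * vector_derivative \<phi> (at x)) = 0"
      using lk[of \<phi>] \<phi> L2_integrable_mult[OF L2_cnj[OF h] TL[OF \<phi>]] L2_integrable_mult[OF L2_cnj[OF k] TL[OF \<phi>]]
      by (simp add: l_def left_diff_distrib flip: T_def)
  qed
  have ia: "f absolutely_integrable_on {a..b}" if "f \<in> L2 ?M" for f by (rule L2_imp_absolutely_integrable[OF that])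
  have io: "f integrable_on {a..b}" if "f \<in> L2 ?M" for f by (rule set_lebesgue_integral_eq_integral(1)[OF ia[OF that]])
  have Ih: "integral {a..b} h = 0" using has_ac_derivativeD(2)[OF y, of b] ab zero by simp
  have ac_v: "has_ac_derivative (v n) (T (v n)) a b" for n
    unfolding T_def by (rule test_function_has_ac_derivative[OF tv])
  have v0: "v n a = 0" "v n b = 0" for n using test_function_zero[OF tv] by auto
  \<comment> \<open>Derivatives of test functions have integral 0 and the integral is continuous in
    mean square, so \<open>k\<close> has integral 0 too; \<open>h\<close> has it by the boundary
    values of \<open>y\<close>.\<close>
  have "(cmod (integral {a..b} k))\<^sup>2 \<le> (b - a) * sqnorm ?M (\<lambda>x. T (v n) x - k x)" for n
  proof -
    have "integral {a..b} (T (v n)) = 0" using has_ac_derivativeD(2)[OF ac_v, of b n] ab v0[of n] by simp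
    then have "integral {a..b} (\<lambda>x. T (v n) x - k x) = - integral {a..b} k"
      using integral_diff[OF io[OF TL[OF tv[of n]]] io[OF k]] by simp
    then show ?thesis using primitive_sq_le[OF L2_diff[OF TL[OF tv[of n]] k], of b] ab by simp
  qed
  moreover have "(\<lambda>n. (b - a) * sqnorm ?M (\<lambda>x. T (v n) x - k x)) \<longlonglongrightarrow> 0"
    using lim by (rule tendsto_mult_right_zero)
  ultimately have "(cmod (integral {a..b} k))\<^sup>2 \<le> 0"
    by (intro LIMSEQ_le_const) auto
  then have Ik: "integral {a..b} k = 0" by simp
  \<comment> \<open>Integrating the constant difference gives
    \<open>(b - a) * c = 0\<close>.\<close>
  have "(LINT x|?M. cnj (k x) - cnj (h x)) = (LINT x|?M. c)"
    using c L2_measurable[OF L2_diff[OF L2_cnj[OF k] L2_cnj[OF h]]] by (intro integral_cong_AE) auto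
  moreover have "(LINT x|?M. cnj (k x) - cnj (h x)) = cnj (LINT x|?M. k x) - cnj (LINT x|?M. h x)"
    using ia[OF k] ia[OF h] by (subst Bochner_Integration.integral_diff) (auto simp: integrable_Ioo_iff[symmetric])
  ultimately have "c = 0"
    using ab by (simp add: integral_Ioo[OF ia[OF k]] integral_Ioo[OF ia[OF h]] Ih Ik measure_restrict_space)
  with c have kh: "AE x in ?M. k x = h x" by (auto elim!: eventually_mono simp flip: complex_cnj_diff)
  have lim': "(\<lambda>n. sqnorm ?M (\<lambda>x. h x - T (v n) x)) \<longlonglongrightarrow> 0"
  proof -
    have "sqnorm ?M (\<lambda>x. h x - T (v n) x) = sqnorm ?M (\<lambda>x. T (v n) x - k x)" for n
      unfolding sqnorm_minus_commute[of ?M h]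
      using kh by (intro sqnorm_cong_AE L2_measurable L2_diff TL tv h k) (auto elim: eventually_mono)
    with lim show ?thesis by simp
  qed
  have "\<exists>\<phi>. test_function ?J \<phi> \<and> W12_norm ?J (\<lambda>x. y x - \<phi> x) < \<epsilon>" if "\<epsilon> > 0" for \<epsilon>
  proof -
    have "(\<lambda>n. (1 + (b - a)\<^sup>2) * sqnorm ?M (\<lambda>x. h x - T (v n) x)) \<longlonglongrightarrow> 0"
      using lim' by (rule tendsto_mult_right_zero)
    then have "\<forall>\<^sub>F n in sequentially. (1 + (b - a)\<^sup>2) * sqnorm ?M (\<lambda>x. h x - T (v n) x) < \<epsilon>\<^sup>2"
      using that by (intro order_tendstoD) auto
    then obtain n where n: "(1 + (b - a)\<^sup>2) * sqnorm ?M (\<lambda>x. h x - T (v n) x) < \<epsilon>\<^sup>2"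
      using eventually_happens'[OF sequentially_bot] by blast
    have "(W12_norm ?J (\<lambda>x. y x - v n x))\<^sup>2 \<le> (1 + (b - a)\<^sup>2) * sqnorm ?M (\<lambda>x. h x - T (v n) x)"
      by (rule W12_norm_le[OF has_ac_derivative_diff[OF y ac_v] L2_diff[OF h TL[OF tv]] ab]) (simp add: zero v0)
    with n have "(W12_norm ?J (\<lambda>x. y x - v n x))\<^sup>2 < \<epsilon>\<^sup>2" by linarith
    then have "W12_norm ?J (\<lambda>x. y x - v n x) < \<epsilon>" by (rule power2_less_imp_less) (use that in simp)
    with tv show ?thesis by blast
  qed
  with has_ac_derivative_W12(1)[OF y h ab] show ?thesis by (auto simp: W12_0_def)
qed

text \<open>The converse of \<open>has_ac_derivative_W12_0\<close>. Test functions near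
  \<open>\<phi>\<close> in the W12 norm are uniformly near the primitive \<open>Y\<close> of its
  weak derivative and near \<open>\<phi>\<close> in mean square. So \<open>Y\<close> vanishes at
  \<open>b\<close> and equals \<open>\<phi>\<close> in mean square, hence everywhere by
  continuity.\<close>

lemma W12_0_has_ac_derivative:
  assumes \<phi>: "\<phi> \<in> W12_0 {a<..<b}" and ab: "a < b"
  shows "has_ac_derivative \<phi> (weak_deriv {a<..<b} \<phi>) a b" "\<phi> a = 0" "\<phi> b = 0"
proof -
  let ?M = "Ioo_measure a b" and ?J = "{a<..<b}"
  define g where "g = weak_deriv ?J \<phi>"
  have W: "\<phi> \<in> W12 ?J" using \<phi> by (simp add: W12_0_def)
  have g: "g \<in> L2 ?M" and wg: "has_weak_derivative_on \<phi> g ?J"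
    unfolding g_def using weak_deriv_W12[OF W] by auto
  have cont: "continuous_on {a..b} \<phi>" using W ab by (simp add: W12_def)
  have \<phi>L: "\<phi> \<in> L2 ?M" by (rule L2_continuous[OF cont])
  define Y where "Y x = integral {a..x} g" for x
  have Y: "has_ac_derivative Y g a b"
    by (rule has_ac_derivative_primitive[OF L2_imp_absolutely_integrable[OF g], of _ 0]) (simp add: Y_def)
  have contY: "continuous_on {a..b} Y" by (rule has_ac_derivative_continuous_on[OF Y])
  have Ya: "Y a = 0" by (simp add: Y_def)
  have approx: "\<exists>\<psi>. test_function ?J \<psi> \<and> sqnorm ?M (\<lambda>x. \<phi> x - \<psi> x) \<le> e \<and>
     (\<forall>x\<in>{a..b}. (cmod (Y x - \<psi> x))\<^sup>2 \<le> (b - a) * e)" if e: "e > 0" for e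
  proof -
    have "sqrt e > 0" using e by simp
    then obtain \<psi> where \<psi>: "test_function ?J \<psi>" and n: "W12_norm ?J (\<lambda>x. \<phi> x - \<psi> x) < sqrt e"
      using \<phi> unfolding W12_0_def by blast
    let ?d = "\<lambda>x. vector_derivative \<psi> (at x)" and ?u = "\<lambda>x. \<phi> x - \<psi> x"
    have ac\<psi>: "has_ac_derivative \<psi> ?d a b" by (rule test_function_has_ac_derivative[OF \<psi>])
    have dL: "?d \<in> L2 ?M" by (rule test_function_deriv_L2[OF \<psi>])
    have \<psi>L: "\<psi> \<in> L2 ?M" by (rule test_function_L2[OF \<psi>])
    have uL: "?u \<in> L2 ?M" by (intro L2_diff \<phi>L \<psi>L)
    have gdL: "(\<lambda>x. g x - ?d x) \<in> L2 ?M" by (intro L2_diff g dL)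
    \<comment> \<open>\<open>weak_deriv\<close> chooses for each function separately and is not
      linear by construction, so the weak derivative of the difference is identified before the norm
      is evaluated.\<close>
    have weak: "has_weak_derivative_on ?u (\<lambda>x. g x - ?d x) ?J"
      unfolding has_weak_derivative_on_def set_lebesgue_integral_Ioo
    proof (intro allI impI)
      fix \<eta> assume \<eta>: "test_function ?J \<eta>"
      have "(LINT x|?M. \<phi> x * vector_derivative \<eta> (at x)) = - (LINT x|?M. g x * \<eta> x)"
        "(LINT x|?M. \<psi> x * vector_derivative \<eta> (at x)) = - (LINT x|?M. ?d x * \<eta> x)"
        using wg has_ac_derivative_weak[OF ac\<psi> ab] \<eta>
        unfolding has_weak_derivative_on_def set_lebesgue_integral_Ioo by auto
      then show "(LINT x|?M. ?u x * vector_derivative \<eta> (at x)) = - (LINT x|?M. (g x - ?d x) * \<eta> x)"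
        using L2_integrable_mult[OF \<phi>L test_function_deriv_L2[OF \<eta>]] L2_integrable_mult[OF \<psi>L test_function_deriv_L2[OF \<eta>]]
          L2_integrable_mult[OF g test_function_L2[OF \<eta>]] L2_integrable_mult[OF dL test_function_L2[OF \<eta>]]
        by (simp add: left_diff_distrib)
    qed
    have uW: "?u \<in> W12 ?J"
      unfolding W12_def square_integrable_on_iff_L2 using ab uL gdL weak
      by (auto intro!: continuous_intros cont test_function_cont_deriv(1)[OF \<psi>])
    have "AE x in ?M. weak_deriv ?J ?u x = g x - ?d x"
      by (rule weak_derivative_unique[OF weak_deriv_W12(1)[OF uW] gdL weak_deriv_W12(2)[OF uW] weak])
    then have eq: "sqnorm ?M (weak_deriv ?J ?u) = sqnorm ?M (\<lambda>x. g x - ?d x)"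
      by (intro sqnorm_cong_AE L2_measurable weak_deriv_W12(1)[OF uW] gdL)
    have "sqnorm ?M ?u + sqnorm ?M (\<lambda>x. g x - ?d x) < e"
      using n by (simp add: W12_norm_eq eq)
    then have s: "sqnorm ?M ?u \<le> e" "sqnorm ?M (\<lambda>x. g x - ?d x) \<le> e"
      using sqnorm_nonneg[of ?M ?u] sqnorm_nonneg[of ?M "\<lambda>x. g x - ?d x"] by linarith+
    have "(cmod (Y x - \<psi> x))\<^sup>2 \<le> (b - a) * e" if x: "x \<in> {a..b}" for x
    proof -
      have "\<psi> a = 0" using test_function_zero[OF \<psi>] by simp
      then have "Y x - \<psi> x = integral {a..x} (\<lambda>x. g x - ?d x)"
        using has_ac_derivativeD(2)[OF has_ac_derivative_diff[OF Y ac\<psi>] x] Ya by simp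
      then have "(cmod (Y x - \<psi> x))\<^sup>2 \<le> (b - a) * sqnorm ?M (\<lambda>x. g x - ?d x)"
        using primitive_sq_le[OF gdL x] by simp
      also have "\<dots> \<le> (b - a) * e" using s ab by (intro mult_left_mono) auto
      finally show ?thesis .
    qed
    with \<psi> s show ?thesis by blast
  qed
  have "(cmod (Y b))\<^sup>2 \<le> 0"
  proof (rule field_le_epsilon)
    fix e :: real assume e: "e > 0"
    then have "e / (b - a) > 0" using ab by simp
    from approx[OF this] obtain \<psi> where \<psi>: "test_function ?J \<psi>" "\<forall>x\<in>{a..b}. (cmod (Y x - \<psi> x))\<^sup>2 \<le> (b - a) * (e / (b - a))"
      by blast
    then have "(cmod (Y b - \<psi> b))\<^sup>2 \<le> (b - a) * (e / (b - a))" using ab by simp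
    then show "(cmod (Y b))\<^sup>2 \<le> 0 + e" using test_function_zero[OF \<psi>(1), of b] ab by simp
  qed
  then have Yb: "Y b = 0" by simp
  have "sqnorm ?M (\<lambda>x. Y x - \<phi> x) \<le> 0"
  proof (rule field_le_epsilon)
    fix e :: real assume e: "e > 0"
    \<comment> \<open>\<open>K\<close> collects the factors of the two squared errors, so that
      \<open>e / K\<close> in \<open>approx\<close> ends in exactly \<open>e\<close>.\<close>
    define K where "K = 2 * (b - a)\<^sup>2 + 2"
    have K: "K > 0" unfolding K_def by (intro add_nonneg_pos) auto
    have Kt: "2 * ((b - a) * ((b - a) * t)) + 2 * t = K * t" for t
      by (simp add: K_def power2_eq_square algebra_simps)
    from approx[of "e / K"] e K obtain \<psi> where \<psi>: "test_function ?J \<psi>" "sqnorm ?M (\<lambda>x. \<phi> x - \<psi> x) \<le> e / K"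
      "\<forall>x\<in>{a..b}. (cmod (Y x - \<psi> x))\<^sup>2 \<le> (b - a) * (e / K)" by auto
    have 1: "sqnorm ?M (\<lambda>x. Y x - \<psi> x) \<le> (b - a) * ((b - a) * (e / K))"
      using ab \<psi>(3) by (intro sqnorm_le_sup continuous_intros contY test_function_cont_deriv(1)[OF \<psi>(1)]) auto
    have "sqnorm ?M (\<lambda>x. (Y x - \<psi> x) + (\<psi> x - \<phi> x)) \<le> 2 * sqnorm ?M (\<lambda>x. Y x - \<psi> x) + 2 * sqnorm ?M (\<lambda>x. \<psi> x - \<phi> x)"
      by (intro sqnorm_add_le L2_diff L2_continuous[OF contY] \<phi>L test_function_L2[OF \<psi>(1)])
    also have "\<dots> \<le> 2 * ((b - a) * ((b - a) * (e / K))) + 2 * (e / K)"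
      using 1 \<psi>(2) by (simp add: sqnorm_minus_commute[of _ \<psi>])
    also have "\<dots> = K * (e / K)" by (rule Kt)
    also have "\<dots> = e" using K by simp
    finally show "sqnorm ?M (\<lambda>x. Y x - \<phi> x) \<le> 0 + e" by simp
  qed
  then have "sqnorm ?M (\<lambda>x. Y x - \<phi> x) = 0" using sqnorm_nonneg[of ?M "\<lambda>x. Y x - \<phi> x"] by linarith
  moreover have c2: "continuous_on {a..b} (\<lambda>x. (cmod (Y x - \<phi> x))\<^sup>2)"
    by (intro continuous_intros contY cont)
  ultimately have "integral {a..b} (\<lambda>x. (cmod (Y x - \<phi> x))\<^sup>2) = 0"
    by (simp add: sqnorm_def integral_Ioo absolutely_integrable_continuous_real)
  then have eq: "Y x = \<phi> x" if "x \<in> {a..b}" for x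
    using that integral_eq_0_iff[OF c2 ab] by simp
  show "has_ac_derivative \<phi> (weak_deriv {a<..<b} \<phi>) a b"
    unfolding g_def[symmetric] using eq by (rule has_ac_derivative_cong[OF Y]) auto
  show "\<phi> a = 0" "\<phi> b = 0" using eq[of a] eq[of b] Ya Yb ab by auto
qed

text \<open>By Poincare, \<open>q\<close> of a primitive is bounded in terms of its density alone.
  The Riesz representation is therefore applied on the space of densities with integral 0, whose
  primitives vanish at both ends.\<close>

lemma W_minus12_representation:
  assumes q: "q \<in> W_minus12 {a<..<b}" and ab: "a < b"
  obtains Q where "Q \<in> L2 (Ioo_measure a b)"
    "\<And>y h. has_ac_derivative y h a b \<Longrightarrow> h \<in> L2 (Ioo_measure a b) \<Longrightarrow> y a = 0 \<Longrightarrow> y b = 0 \<Longrightarrow>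
       q y = - (LINT x|Ioo_measure a b. Q x * h x)"
proof -
  let ?M = "Ioo_measure a b" and ?J = "{a<..<b}"
  obtain C where qadd: "\<And>\<phi> \<psi>. \<phi> \<in> W12_0 ?J \<Longrightarrow> \<psi> \<in> W12_0 ?J \<Longrightarrow> q (\<lambda>x. \<phi> x + \<psi> x) = q \<phi> + q \<psi>"
    and qmult: "\<And>c \<phi>. \<phi> \<in> W12_0 ?J \<Longrightarrow> q (\<lambda>x. c * \<phi> x) = c * q \<phi>"
    and qb: "\<And>\<phi>. \<phi> \<in> W12_0 ?J \<Longrightarrow> cmod (q \<phi>) \<le> C * W12_norm ?J \<phi>"
    using q unfolding W_minus12_def by blast
  define C' where "C' = C\<^sup>2 * (1 + (b - a)\<^sup>2)"
  have bound: "(cmod (q y))\<^sup>2 \<le> C' * sqnorm ?M h"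
    if "has_ac_derivative y h a b" "h \<in> L2 ?M" "y a = 0" "y b = 0" for y h
  proof -
    have "(cmod (q y))\<^sup>2 \<le> (C * W12_norm ?J y)\<^sup>2"
      using qb[OF has_ac_derivative_W12_0[OF that(1,2) ab that(3,4)]] by (intro power_mono) auto
    also have "\<dots> \<le> C\<^sup>2 * ((1 + (b - a)\<^sup>2) * sqnorm ?M h)"
      unfolding power_mult_distrib using W12_norm_le[OF that(1,2) ab that(3)] by (intro mult_left_mono) auto
    finally show ?thesis by (simp add: C'_def mult.assoc)
  qed
  \<comment> \<open>The clamping at \<open>b\<close> makes the primitive additive as a function on all of the real line.\<close>
  define P where "P h x = integral {a..min x b} h" for h :: "real \<Rightarrow> complex" and x
  define V where "V = {h \<in> L2 ?M. integral {a..b} h = 0}"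
  have VL: "h \<in> L2 ?M" if "h \<in> V" for h using that by (simp add: V_def)
  have io: "h integrable_on {a..min x b}" if "h \<in> L2 ?M" for h x
    by (rule set_lebesgue_integral_eq_integral(1)[OF absolutely_integrable_on_subinterval[OF L2_imp_absolutely_integrable[OF that]]]) auto
  have PV: "has_ac_derivative (P h) h a b" "P h a = 0" "P h b = 0" if "h \<in> V" for h
  proof -
    show "has_ac_derivative (P h) h a b"
      by (rule has_ac_derivative_primitive[OF L2_imp_absolutely_integrable[OF VL[OF that]], of _ 0]) (simp add: P_def)
    show "P h a = 0" "P h b = 0" using that ab by (auto simp: P_def V_def)
  qed
  have PW: "P h \<in> W12_0 ?J" if "h \<in> V" for h
    by (rule has_ac_derivative_W12_0[OF PV(1)[OF that] VL[OF that] ab PV(2,3)[OF that]])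
  have Vadd: "(\<lambda>x. u x + w x) \<in> V" if "u \<in> V" "w \<in> V" for u w
    using that integral_add[OF io[of u b] io[of w b]] by (auto simp: V_def L2_add)
  have Vmult: "(\<lambda>x. c * u x) \<in> V" if "u \<in> V" for u c
    using that by (auto simp: V_def L2_cmult)
  have Padd: "P (\<lambda>x. u x + w x) = (\<lambda>x. P u x + P w x)" if "u \<in> V" "w \<in> V" for u w
    unfolding P_def by (intro ext integral_add io VL that)
  have Pmult: "P (\<lambda>x. c * u x) = (\<lambda>x. c * P u x)" for u c
    by (simp add: P_def fun_eq_iff)
  obtain k where k: "k \<in> L2 ?M" "\<And>h. h \<in> V \<Longrightarrow> q (P h) = (LINT x|?M. cnj (k x) * h x)"
  proof (rule L2_Riesz[of "\<lambda>x. 0" V "\<lambda>h. h" ?M "\<lambda>h. q (P h)" C'])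
    show "(\<lambda>x. 0) \<in> V" by (simp add: V_def L2_const)
    fix u w c assume u: "u \<in> V"
    show "(\<lambda>x. c * u x) \<in> V" by (rule Vmult[OF u])
    show "u \<in> L2 ?M" by (rule VL[OF u])
    show "q (P (\<lambda>x. c * u x)) = c * q (P u)" unfolding Pmult by (rule qmult[OF PW[OF u]])
    show "(cmod (q (P u)))\<^sup>2 \<le> C' * sqnorm ?M u" by (rule bound[OF PV(1)[OF u] VL[OF u] PV(2,3)[OF u]])
    assume w: "w \<in> V"
    show "(\<lambda>x. u x + w x) \<in> V" by (rule Vadd[OF u w])
    show "q (P (\<lambda>x. u x + w x)) = q (P u) + q (P w)" unfolding Padd[OF u w] by (rule qadd[OF PW[OF u] PW[OF w]])
  qed auto
  have rep: "q y = (LINT x|?M. cnj (k x) * h x)"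
    if y: "has_ac_derivative y h a b" and h: "h \<in> L2 ?M" and z: "y a = 0" "y b = 0" for y h
  proof -
    have hV: "h \<in> V" using has_ac_derivativeD(2)[OF y, of b] ab h z by (simp add: V_def)
    \<comment> \<open>\<open>y\<close> and \<open>P h\<close> agree on the closed interval but
      perhaps not outside it, and \<open>q\<close> takes functions on the whole line. Their
      difference has density 0, so \<open>bound\<close> sends it to 0.\<close>
    have d: "has_ac_derivative (\<lambda>x. y x - P h x) (\<lambda>x. h x - h x) a b"
      by (rule has_ac_derivative_diff[OF y PV(1)[OF hV]])
    have L0: "(\<lambda>x. h x - h x) \<in> L2 ?M" by (simp add: L2_const)
    have "(cmod (q (\<lambda>x. y x - P h x)))\<^sup>2 \<le> C' * sqnorm ?M (\<lambda>x. h x - h x)"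
      using z PV(2,3)[OF hV] by (intro bound[OF d L0]) auto
    then have "q (\<lambda>x. y x - P h x) = 0" by (simp add: sqnorm_def)
    moreover have "(\<lambda>x. y x - P h x) \<in> W12_0 ?J"
      using z PV(2,3)[OF hV] by (intro has_ac_derivative_W12_0[OF d L0 ab]) auto
    ultimately show ?thesis using qadd[OF _ PW[OF hV], of "\<lambda>x. y x - P h x"] k(2)[OF hV] by simp
  qed
  show ?thesis
  proof (rule that)
    \<comment> \<open>The conjugate comes from the Hermitian form of the Riesz lemma, the sign from
      \<open>q = Q'\<close>, which acts as minus the pairing of \<open>Q\<close> with the
      derivative.\<close>
    show "(\<lambda>x. -1 * cnj (k x)) \<in> L2 ?M" by (intro L2_cmult L2_cnj k)
  qed (simp add: rep)
qed

section \<open>A linear system with integrable coefficients\<close>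

text \<open>Picard iteration for \<open>z\<close> alone, with \<open>v\<close> eliminated through
  \<open>G\<close>. \<open>B\<close> is merely integrable and enters each step only by its total
  mass \<open>N\<close>; the outer integration against the bounded \<open>A\<close> supplies the
  power of \<open>x - a\<close> and hence the factorial.\<close>

lemma Volterra_system_exists:
  fixes A B :: "real \<Rightarrow> complex"
  assumes A: "continuous_on {a..b} A" and B: "B absolutely_integrable_on {a..b}"
  obtains z v where "has_ac_derivative z (\<lambda>x. A x * v x) a b" "has_ac_derivative v (\<lambda>x. B x * z x) a b"
    "z a = \<alpha>" "v a = \<beta>"
proof -
  define G where "G y x = \<beta> + integral {a..x} (\<lambda>s. B s * y s)" for y x
  define F where "F y x = \<alpha> + integral {a..x} (\<lambda>s. A s * G y s)" for y x
  have Bint: "(\<lambda>s. B s * y s) absolutely_integrable_on {a..b}" if "continuous_on {a..b} y" for y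
    using absolutely_integrable_on_Icc_mult_continuous[OF B that] by (simp add: mult.commute)
  have acG: "has_ac_derivative (G y) (\<lambda>s. B s * y s) a b" if "(\<lambda>s. B s * y s) absolutely_integrable_on {a..b}" for y
    by (rule has_ac_derivative_primitive[OF that, of _ \<beta>]) (simp add: G_def)
  have acF: "has_ac_derivative (F y) (\<lambda>s. A s * G y s) a b" if "(\<lambda>s. B s * y s) absolutely_integrable_on {a..b}" for y
    by (rule has_ac_derivative_primitive[OF absolutely_integrable_continuous_real[OF continuous_on_mult[OF A
        has_ac_derivative_continuous_on[OF acG[OF that]]]], of _ \<alpha>]) (simp add: F_def)
  obtain KA where KA: "KA \<ge> 0" "\<And>x. x \<in> {a..b} \<Longrightarrow> cmod (A x) \<le> KA"
    using continuous_on_Icc_bounded[OF A] by blast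
  have nB: "(\<lambda>s. cmod (B s)) integrable_on {a..b}"
    using B by (simp add: absolutely_integrable_on_def)
  have nB': "(\<lambda>s. cmod (B s)) integrable_on {a..x}" if "x \<in> {a..b}" for x
    by (rule integrable_on_subinterval[OF nB]) (use that in auto)
  define N where "N = integral {a..b} (\<lambda>s. cmod (B s))"
  have N0: "N \<ge> 0" unfolding N_def by (intro integral_nonneg nB) auto
  have Gdiff: "cmod (integral {a..x} (\<lambda>s. B s * y s)) \<le> N * K"
    if "(\<lambda>s. B s * y s) absolutely_integrable_on {a..b}" "x \<in> {a..b}" "\<And>s. s \<in> {a..x} \<Longrightarrow> cmod (y s) \<le> K" for y x K
  proof -
    have K: "K \<ge> 0" using order_trans[OF norm_ge_zero that(3)[of a]] that(2) by auto
    have "cmod (integral {a..x} (\<lambda>s. B s * y s)) \<le> integral {a..x} (\<lambda>s. cmod (B s) * K)"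
    proof (rule integral_norm_bound_integral)
      show "(\<lambda>s. B s * y s) integrable_on {a..x}"
        by (rule has_ac_derivative_integrable_on[OF acG[OF that(1)] that(2)])
      show "(\<lambda>s. cmod (B s) * K) integrable_on {a..x}"
        by (intro integrable_on_cmult_right integrable_on_mult_left nB' that)
    qed (auto simp: norm_mult intro!: mult_left_mono that)
    also have "\<dots> = integral {a..x} (\<lambda>s. cmod (B s)) * K" by simp
    also have "\<dots> \<le> N * K"
      unfolding N_def using that(2) by (intro mult_right_mono integral_subset_le nB nB' K) auto
    finally show ?thesis .
  qed
  define M where "M = KA * N"
  have M0: "M \<ge> 0" using KA N0 by (simp add: M_def)
  define S where "S n = (F ^^ n) (\<lambda>x. 0)" for n
  have S0: "S 0 x = 0" and SS: "S (Suc n) = F (S n)" for n x by (simp_all add: S_def)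
  have Scont: "continuous_on {a..b} (S n)" for n
  proof (induction n)
    case (Suc n)
    show ?case unfolding SS by (rule has_ac_derivative_continuous_on[OF acF[OF Bint[OF Suc]]])
  qed (simp add: S0 continuous_on_const cong: continuous_on_cong)
  \<comment> \<open>As \<open>S 0\<close> is zero, a bound for the first iterate starts the estimate
    of successive differences.\<close>
  obtain W where W: "W \<ge> 0" "\<And>x. x \<in> {a..b} \<Longrightarrow> cmod (S 1 x) \<le> W"
    using continuous_on_Icc_bounded[OF Scont] by blast
  have Sdiff: "cmod (S (Suc n) x - S n x) \<le> W * ((M * (x - a)) ^ n / fact n)" if "x \<in> {a..b}" for n x
    using that
  proof (induction n arbitrary: x)
    case 0 then show ?case using W by (simp add: S0)
  next
    case (Suc n)
    note x = Suc.prems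
    define D where "D s = integral {a..s} (\<lambda>t. B t * (S (Suc n) t - S n t))" for s
    have contd: "continuous_on {a..b} (\<lambda>t. S (Suc n) t - S n t)" by (intro continuous_intros Scont)
    have Dcont: "continuous_on {a..b} D" unfolding D_def
      by (rule indefinite_integral_continuous_1[OF set_lebesgue_integral_eq_integral(1)[OF Bint[OF contd]]])
    have GD: "G (S (Suc n)) s - G (S n) s = D s" if "s \<in> {a..b}" for s
      using has_ac_derivative_integrable_on[OF acG[OF Bint[OF Scont]] that, of "Suc n"]
        has_ac_derivative_integrable_on[OF acG[OF Bint[OF Scont]] that, of n]
      by (simp add: G_def D_def integral_diff right_diff_distrib)
    have FD: "F (S (Suc n)) x - F (S n) x = integral {a..x} (\<lambda>s. A s * D s)"
    proof -
      have "F (S (Suc n)) x - F (S n) x = integral {a..x} (\<lambda>s. A s * G (S (Suc n)) s - A s * G (S n) s)"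
        using has_ac_derivative_integrable_on[OF acF[OF Bint[OF Scont]] x, of "Suc n"]
          has_ac_derivative_integrable_on[OF acF[OF Bint[OF Scont]] x, of n]
        by (simp add: F_def integral_diff)
      also have "\<dots> = integral {a..x} (\<lambda>s. A s * D s)"
        using x by (intro integral_cong) (auto simp: GD[symmetric] right_diff_distrib)
      finally show ?thesis .
    qed
    have "cmod (integral {a..x} (\<lambda>s. A s * D s)) \<le> integral {a..x} (\<lambda>s. (KA * N * W * M ^ n / fact n) * (s - a) ^ n)"
    proof (rule integral_norm_bound_integral)
      show "(\<lambda>s. A s * D s) integrable_on {a..x}"
        using x by (intro integrable_continuous_real continuous_intros continuous_on_subset[OF A] continuous_on_subset[OF Dcont]) auto
      show "(\<lambda>s. (KA * N * W * M ^ n / fact n) * (s - a) ^ n) integrable_on {a..x}"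
        by (intro integrable_continuous_real continuous_intros)
      fix s assume s: "s \<in> {a..x}"
      then have sb: "s \<in> {a..b}" using x by auto
      have "cmod (D s) \<le> N * (W * ((M * (s - a)) ^ n / fact n))"
        unfolding D_def
      proof (rule Gdiff[OF Bint[OF contd] sb])
        fix t assume t: "t \<in> {a..s}"
        then have "cmod (S (Suc n) t - S n t) \<le> W * ((M * (t - a)) ^ n / fact n)"
          using sb by (intro Suc.IH) auto
        \<comment> \<open>The estimate at \<open>t\<close> is relaxed to the endpoint
          \<open>s\<close>: integration against \<open>B\<close> gains nothing from the power of
          \<open>t - a\<close>.\<close>
        also have "\<dots> \<le> W * ((M * (s - a)) ^ n / fact n)"
          using t M0 W by (intro mult_left_mono divide_right_mono power_mono) auto
        finally show "cmod (S (Suc n) t - S n t) \<le> W * ((M * (s - a)) ^ n / fact n)" .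
      qed
      then have "cmod (A s * D s) \<le> KA * (N * (W * ((M * (s - a)) ^ n / fact n)))"
        unfolding norm_mult using KA sb by (intro mult_mono) auto
      then show "cmod (A s * D s) \<le> (KA * N * W * M ^ n / fact n) * (s - a) ^ n"
        by (simp add: power_mult_distrib mult_ac)
    qed
    also have "\<dots> = (KA * N * W * M ^ n / fact n) * integral {a..x} (\<lambda>s. (s - a) ^ n)" by simp
    also have "integral {a..x} (\<lambda>s. (s - a) ^ n) = (x - a) ^ Suc n / (Suc n)"
    proof -
      have "((\<lambda>s. (s - a) ^ n) has_integral ((x - a) ^ Suc n / (Suc n) - (a - a) ^ Suc n / (Suc n))) {a..x}"
      proof (rule fundamental_theorem_of_calculus)
        fix s
        have "((\<lambda>s. (s - a) ^ Suc n / (Suc n)) has_real_derivative (s - a) ^ n) (at s within {a..x})"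
          by (auto intro!: derivative_eq_intros simp del: of_nat_Suc power_Suc)
        then show "((\<lambda>s. (s - a) ^ Suc n / (Suc n)) has_vector_derivative (s - a) ^ n) (at s within {a..x})"
          by (simp only: has_real_derivative_iff_has_vector_derivative)
      qed (use x in auto)
      then show ?thesis by (simp add: integral_unique del: of_nat_Suc)
    qed
    also have "(KA * N * W * M ^ n / fact n) * ((x - a) ^ Suc n / (Suc n)) = W * ((M * (x - a)) ^ Suc n / fact (Suc n))"
      by (simp add: M_def power_mult_distrib mult_ac del: of_nat_Suc)
    finally show ?case by (simp only: SS FD[unfolded SS])
  qed
  \<comment> \<open>One bound for all iterates, so that pointwise convergence is enough for
    dominated convergence in \<open>G\<close> and \<open>F\<close>.\<close>
  define K where "K = W * exp (M * (b - a))"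
  have exps: "summable (\<lambda>n. W * ((M * t) ^ n / fact n))" "(\<Sum>n. W * ((M * t) ^ n / fact n)) = W * exp (M * t)" for t
    using exp_converges[of "M * t"] sums_mult[of _ "exp (M * t)" W]
    by (auto simp: sums_iff divide_inverse mult.commute)
  have Ssum: "S n x = (\<Sum>k<n. S (Suc k) x - S k x)" for n x
    by (simp add: sum_lessThan_telescope[of "\<lambda>k. S k x"] S0)
  have Sbound: "cmod (S n x) \<le> K" if x: "x \<in> {a..b}" for n x
  proof -
    have "cmod (S n x) \<le> (\<Sum>k<n. W * ((M * (x - a)) ^ k / fact k))"
      by (subst Ssum, rule order_trans[OF norm_sum]) (intro sum_mono Sdiff x)
    also have "\<dots> \<le> (\<Sum>k. W * ((M * (x - a)) ^ k / fact k))"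
      using x M0 W by (intro sum_le_suminf exps) auto
    also have "\<dots> \<le> K" unfolding exps K_def using x M0 W by (intro mult_left_mono) (auto intro!: mult_left_mono)
    finally show ?thesis .
  qed
  define z where "z x = lim (\<lambda>n. S n x)" for x
  have Slim: "(\<lambda>n. S n x) \<longlonglongrightarrow> z x" if x: "x \<in> {a..b}" for x
  proof -
    have "summable (\<lambda>k. S (Suc k) x - S k x)"
      by (rule summable_comparison_test'[OF exps(1)[of "x - a"]]) (rule Sdiff[OF x])
    then have "convergent (\<lambda>n. S n x)" by (simp add: summable_iff_convergent flip: Ssum)
    then show ?thesis by (simp add: z_def convergent_LIMSEQ_iff)
  qed
  have bd: "cmod (B s * S n s) \<le> cmod (B s) * K" if "s \<in> {a..b}" for n s
    unfolding norm_mult by (intro mult_left_mono Sbound that) auto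
  have Bz: "(\<lambda>s. B s * z s) absolutely_integrable_on {a..b}"
  proof (rule dominated_convergence_absolutely_integrable)
    show "(\<lambda>s. B s * S n s) absolutely_integrable_on {a..b}" for n by (rule Bint[OF Scont])
    show "(\<lambda>s. cmod (B s) * K) integrable_on {a..b}" by (intro integrable_on_mult_left nB)
    fix s assume s: "s \<in> {a..b}"
    show lim: "(\<lambda>n. B s * S n s) \<longlonglongrightarrow> B s * z s" by (intro tendsto_intros Slim s)
    show "cmod (B s * z s) \<le> cmod (B s) * K"
      by (rule LIMSEQ_le_const2[OF tendsto_norm[OF lim]]) (use bd[OF s] in auto)
  qed
  have Glim: "(\<lambda>n. G (S n) x) \<longlonglongrightarrow> G z x" if x: "x \<in> {a..b}" for x
    unfolding G_def
  proof (intro tendsto_add tendsto_const dominated_convergence(2))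
    show "(\<lambda>s. B s * S n s) integrable_on {a..x}" for n
      by (rule has_ac_derivative_integrable_on[OF acG[OF Bint[OF Scont]] x])
    show "(\<lambda>s. cmod (B s) * K) integrable_on {a..x}" by (intro integrable_on_mult_left nB' x)
    fix s assume s: "s \<in> {a..x}"
    then show "(\<lambda>n. B s * S n s) \<longlonglongrightarrow> B s * z s" using x by (intro tendsto_intros Slim) auto
    show "cmod (B s * S n s) \<le> cmod (B s) * K" for n using s x by (intro bd) auto
  qed
  have Gb: "cmod (G (S n) x) \<le> cmod \<beta> + N * K" if x: "x \<in> {a..b}" for n x
    unfolding G_def
  proof (rule order_trans[OF norm_triangle_ineq], rule add_left_mono, rule Gdiff[OF Bint[OF Scont] x])
    fix s assume "s \<in> {a..x}" then show "cmod (S n s) \<le> K" using x by (intro Sbound) auto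
  qed
  have Flim: "(\<lambda>n. F (S n) x) \<longlonglongrightarrow> F z x" if x: "x \<in> {a..b}" for x
    unfolding F_def
  proof (intro tendsto_add tendsto_const dominated_convergence(2))
    show "(\<lambda>s. A s * G (S n) s) integrable_on {a..x}" for n
      by (rule has_ac_derivative_integrable_on[OF acF[OF Bint[OF Scont]] x])
    show "(\<lambda>s. KA * (cmod \<beta> + N * K)) integrable_on {a..x}"
      by (intro integrable_continuous_real continuous_on_const)
    fix s assume s: "s \<in> {a..x}"
    then show "(\<lambda>n. A s * G (S n) s) \<longlonglongrightarrow> A s * G z s" using x by (intro tendsto_intros Glim) auto
    show "cmod (A s * G (S n) s) \<le> KA * (cmod \<beta> + N * K)" for n 
      unfolding norm_mult using s x KA by (intro mult_mono Gb) auto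
  qed
  have zF: "z x = F z x" if x: "x \<in> {a..b}" for x
    using LIMSEQ_unique[OF LIMSEQ_Suc[OF Slim[OF x]]] Flim[OF x] by (simp add: SS)
  define v where "v = G z"
  have "has_ac_derivative (F z) (\<lambda>x. A x * v x) a b" unfolding v_def by (rule acF[OF Bz])
  \<comment> \<open>Values off the interval are reset to \<open>\<alpha>\<close>, so that the
    initial value is right even when the interval is empty.\<close>
  then have "has_ac_derivative (\<lambda>x. if x \<in> {a..b} then z x else \<alpha>) (\<lambda>x. A x * v x) a b"
    by (rule has_ac_derivative_cong) (simp_all add: zF)
  moreover have "has_ac_derivative v (\<lambda>x. B x * (if x \<in> {a..b} then z x else \<alpha>)) a b"
    unfolding v_def using acG[OF Bz] by (rule has_ac_derivative_cong) simp_all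
  moreover have "(if a \<in> {a..b} then z a else \<alpha>) = \<alpha>" using zF[of a] by (simp add: F_def)
  moreover have "v a = \<beta>" by (simp add: v_def G_def)
  ultimately show ?thesis using that by blast
qed

text \<open>At a zero of \<open>w\<close> every \<open>c\<close> works, as \<open>z\<close> is
  nonzero there. Elsewhere \<open>c\<close> must avoid the values of a quotient that is
  differentiable from a subset of the line into a plane of real dimension 2.\<close>

lemma nonvanishing_combination:
  fixes z w :: "real \<Rightarrow> complex"
  assumes "z differentiable_on S" "w differentiable_on S"
    and "\<And>x. x \<in> S \<Longrightarrow> z x \<noteq> 0 \<or> w x \<noteq> 0"
  obtains c where "\<And>x. x \<in> S \<Longrightarrow> z x + c * w x \<noteq> 0"
proof -
  let ?T = "{x \<in> S. w x \<noteq> 0}"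
  have d: "z differentiable_on ?T" "w differentiable_on ?T"
    using assms(1,2) by (auto intro: differentiable_on_subset)
  have "(\<lambda>x. - z x / w x) differentiable_on ?T"
    unfolding differentiable_on_def
  proof
    fix x assume x: "x \<in> ?T"
    from d x obtain z' w' where "(z has_derivative z') (at x within ?T)" "(w has_derivative w') (at x within ?T)"
      unfolding differentiable_on_def differentiable_def by blast
    from has_derivative_divide[OF has_derivative_minus[OF this(1)] this(2)] x
    show "(\<lambda>x. - z x / w x) differentiable (at x within ?T)" unfolding differentiable_def by blast
  qed
  then have "negligible ((\<lambda>x. - z x / w x) ` ?T)"
    by (rule negligible_differentiable_image_lowdim[rotated]) simp
  then have "(\<lambda>x. - z x / w x) ` ?T \<noteq> UNIV" using non_negligible_UNIV by metis
  then obtain c where c: "c \<notin> (\<lambda>x. - z x / w x) ` ?T" by blast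
  have "z x + c * w x \<noteq> 0" if x: "x \<in> S" for x
  proof (cases "w x = 0")
    case False
    show ?thesis
    proof
      assume "z x + c * w x = 0"
      then have "c = - z x / w x" using False by (simp add: field_simps eq_neg_iff_add_eq_0)
      then show False using c x False by blast
    qed
  qed (use assms(3)[OF x] in auto)
  then show ?thesis by (rule that)
qed

text \<open>A continuous density upgrades the integral formula to a derivative at every point,
  one-sided at the ends. For \<open>z1\<close> and \<open>z2\<close> the density is a product of
  continuous functions, since \<open>A\<close> is continuous.\<close>

lemma has_ac_derivative_differentiable_on:
  assumes "has_ac_derivative z f a b" "continuous_on {a..b} f"
  shows "z differentiable_on {a..b}"
  unfolding differentiable_on_def
proof
  fix x assume x: "x \<in> {a..b}"
  have "((\<lambda>x. z a + integral {a..x} f) has_vector_derivative 0 + f x) (at x within {a..b})"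
    by (intro has_vector_derivative_add has_vector_derivative_const integral_has_vector_derivative assms(2) x)
  then have "(z has_vector_derivative 0 + f x) (at x within {a..b})"
    by (rule has_vector_derivative_transform[OF x, rotated]) (rule has_ac_derivativeD(2)[OF assms(1)])
  then show "z differentiable at x within {a..b}"
    by (auto simp: has_vector_derivative_def differentiable_def)
qed

theorem theorem4:
  fixes a b :: real and q :: "(real \<Rightarrow> complex) \<Rightarrow> complex"
  assumes "a < b"
    and "q \<in> W_minus12 {a<..<b}"
  shows "admissible {a<..<b} q"
proof -
  let ?M = "Ioo_measure a b" and ?J = "{a<..<b}"
  note ab = assms(1)
  obtain Q where Q: "Q \<in> L2 ?M"
    and rep: "\<And>y h. has_ac_derivative y h a b \<Longrightarrow> h \<in> L2 ?M \<Longrightarrow> y a = 0 \<Longrightarrow> y b = 0 \<Longrightarrow>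
       q y = - (LINT x|?M. Q x * h x)"
    using W_minus12_representation[OF assms(2,1)] by blast
  define P where "P x = integral {a..x} Q" for x
  have P: "has_ac_derivative P Q a b"
    by (rule has_ac_derivative_primitive[OF L2_imp_absolutely_integrable[OF Q], of _ 0]) (simp add: P_def)
  have Pc: "continuous_on {a..b} P" by (rule has_ac_derivative_continuous_on[OF P])
  define A where "A x = exp (- 2 * P x)" for x
  define B where "B x = - exp (2 * P x) * (Q x * Q x)" for x
  have Ac: "continuous_on {a..b} A" unfolding A_def by (intro continuous_intros Pc)
  have Bi: "B absolutely_integrable_on {a..b}"
    unfolding B_def
    by (intro absolutely_integrable_on_Icc_mult_continuous L2_mult_absolutely_integrable Q continuous_intros Pc)
  obtain z1 v1 where 1: "has_ac_derivative z1 (\<lambda>x. A x * v1 x) a b" "has_ac_derivative v1 (\<lambda>x. B x * z1 x) a b"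
    "z1 a = 1" "v1 a = 0" using Volterra_system_exists[OF Ac Bi] by blast
  obtain z2 v2 where 2: "has_ac_derivative z2 (\<lambda>x. A x * v2 x) a b" "has_ac_derivative v2 (\<lambda>x. B x * z2 x) a b"
    "z2 a = 0" "v2 a = 1" using Volterra_system_exists[OF Ac Bi] by blast
  \<comment> \<open>The coefficient matrix has zero diagonal, so the Wronskian has density 0 and
    keeps its value at \<open>a\<close>, which the initial data make 1.\<close>
  have Wronskian: "z1 x * v2 x - z2 x * v1 x = 1" if x: "x \<in> {a..b}" for x
  proof -
    have ac: "has_ac_derivative (\<lambda>x. z1 x * v2 x - z2 x * v1 x)
      (\<lambda>x. (A x * v1 x * v2 x + z1 x * (B x * z2 x)) - (A x * v2 x * v1 x + z2 x * (B x * z1 x))) a b"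
      by (intro has_ac_derivative_diff has_ac_derivative_mult 1 2)
    have 0: "(\<lambda>x. (A x * v1 x * v2 x + z1 x * (B x * z2 x)) - (A x * v2 x * v1 x + z2 x * (B x * z1 x))) = (\<lambda>x. 0)"
      by (simp add: fun_eq_iff mult_ac)
    show ?thesis using has_ac_derivativeD(2)[OF ac x] unfolding 0 by (simp add: 1 2)
  qed
  obtain c where c: "\<And>x. x \<in> {a..b} \<Longrightarrow> z1 x + c * z2 x \<noteq> 0"
  proof (rule nonvanishing_combination[of z1 "{a..b}" z2])
    show "z1 differentiable_on {a..b}"
      by (rule has_ac_derivative_differentiable_on[OF 1(1) continuous_on_mult[OF Ac has_ac_derivative_continuous_on[OF 1(2)]]])
    show "z2 differentiable_on {a..b}"
      by (rule has_ac_derivative_differentiable_on[OF 2(1) continuous_on_mult[OF Ac has_ac_derivative_continuous_on[OF 2(2)]]])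
    show "z1 x \<noteq> 0 \<or> z2 x \<noteq> 0" if "x \<in> {a..b}" for x using Wronskian[OF that] by auto
  qed blast
  define z where "z x = z1 x + c * z2 x" for x
  define v where "v x = v1 x + c * v2 x" for x
  have z: "has_ac_derivative z (\<lambda>x. A x * v x) a b"
    using has_ac_derivative_add[OF 1(1) has_ac_derivative_cmult[OF 2(1), of c]]
    unfolding z_def v_def by (simp add: algebra_simps)
  have v: "has_ac_derivative v (\<lambda>x. B x * z x) a b"
    using has_ac_derivative_add[OF 1(2) has_ac_derivative_cmult[OF 2(2), of c]]
    unfolding z_def v_def by (simp add: algebra_simps)
  define f where "f x = exp (P x) * z x" for x
  define u where "u x = exp (- P x) * v x" for x
  \<comment> \<open>\<open>g\<close> will be the derivative of \<open>f\<close>, and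
    \<open>u = g - Q f\<close> its quasi-derivative: \<open>u\<close> is absolutely continuous,
    whereas \<open>g\<close> is only square-integrable.\<close>
  define g where "g x = Q x * f x + u x" for x
  have EA: "exp (P x) * A x = exp (- P x)" for x
    unfolding A_def by (simp flip: exp_add)
  have EB: "exp (- P x) * B x = - (Q x * Q x * exp (P x))" for x
  proof -
    have "exp (- P x) * exp (2 * P x) = exp (P x)" by (simp flip: exp_add)
    then show ?thesis unfolding B_def by (simp add: mult_ac)
  qed
  have f: "has_ac_derivative f g a b"
  proof (rule has_ac_derivative_cong)
    show "has_ac_derivative (\<lambda>x. exp (P x) * z x) (\<lambda>x. exp (P x) * Q x * z x + exp (P x) * (A x * v x)) a b"
      by (intro has_ac_derivative_mult has_ac_derivative_exp P z)
    show "exp (P x) * Q x * z x + exp (P x) * (A x * v x) = g x" for x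
      by (simp add: g_def f_def u_def EA[symmetric] mult_ac)
  qed (simp add: f_def)
  have u: "has_ac_derivative u (\<lambda>x. - (Q x * u x) - Q x * Q x * f x) a b"
  proof (rule has_ac_derivative_cong)
    show "has_ac_derivative (\<lambda>x. exp (-1 * P x) * v x) (\<lambda>x. exp (-1 * P x) * (-1 * Q x) * v x + exp (-1 * P x) * (B x * z x)) a b"
      by (intro has_ac_derivative_mult has_ac_derivative_exp has_ac_derivative_cmult P v)
    fix x
    have "exp (- P x) * (B x * z x) = - (Q x * Q x * f x)"
      using EB[of x] by (simp add: f_def flip: mult.assoc)
    then show "exp (-1 * P x) * (-1 * Q x) * v x + exp (-1 * P x) * (B x * z x) = - (Q x * u x) - Q x * Q x * f x"
      by (simp add: u_def mult_ac)
  qed (simp add: u_def)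
  have fc: "continuous_on {a..b} f" and uc: "continuous_on {a..b} u"
    using has_ac_derivative_continuous_on[OF f] has_ac_derivative_continuous_on[OF u] by auto
  have g: "g \<in> L2 ?M"
    using L2_add[OF L2_continuous_mult[OF fc Q] L2_continuous[OF uc]] by (simp add: g_def[abs_def] mult.commute)
  have fW: "f \<in> W12 ?J" and wf: "AE x in ?M. weak_deriv ?J f x = g x"
    using has_ac_derivative_W12[OF f g ab] by auto
  have zero: "schroedinger ?J q f \<phi> = 0" if \<phi>: "\<phi> \<in> W12_0 ?J" for \<phi>
  proof -
    define w where "w = weak_deriv ?J \<phi>"
    have ac: "has_ac_derivative \<phi> w a b" and z0: "\<phi> a = 0" "\<phi> b = 0"
      unfolding w_def using W12_0_has_ac_derivative[OF \<phi> ab] by auto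
    have w: "w \<in> L2 ?M" unfolding w_def using \<phi> by (intro weak_deriv_W12) (simp add: W12_0_def)
    have \<phi>c: "continuous_on {a..b} \<phi>" by (rule has_ac_derivative_continuous_on[OF ac])
    define h where "h x = g x * \<phi> x + f x * w x" for x
    have h: "h \<in> L2 ?M"
      using L2_add[OF L2_continuous_mult[OF \<phi>c g] L2_continuous_mult[OF fc w]] by (simp add: h_def[abs_def] mult.commute)
    have "has_ac_derivative (\<lambda>x. f x * \<phi> x) h a b"
      unfolding h_def by (rule has_ac_derivative_mult[OF f ac])
    \<comment> \<open>\<open>f * \<phi>\<close> inherits the zeros of \<open>\<phi>\<close> at both
      ends, so the representation of \<open>q\<close> applies to it with the product rule density
      \<open>h\<close>.\<close>
    then have qf: "q (\<lambda>x. f x * \<phi> x) = - (LINT x|?M. Q x * h x)"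
      using h by (rule rep) (simp_all add: z0)
    have "(LINT x|?M. weak_deriv ?J f x * w x) = (LINT x|?M. g x * w x)"
    proof (rule integral_cong_AE)
      show "(\<lambda>x. weak_deriv ?J f x * w x) \<in> borel_measurable ?M"
        by (intro borel_measurable_times L2_measurable weak_deriv_W12(1)[OF fW] w)
      show "(\<lambda>x. g x * w x) \<in> borel_measurable ?M"
        by (intro borel_measurable_times L2_measurable g w)
    qed (use wf in \<open>auto elim: eventually_mono\<close>)
    then have "schroedinger ?J q f \<phi> = (LINT x|?M. g x * w x) - (LINT x|?M. Q x * h x)"
      by (simp add: schroedinger_def qf set_lebesgue_integral_Ioo w_def)
    also have "\<dots> = (LINT x|?M. g x * w x - Q x * h x)"
      using L2_integrable_mult[OF g w] L2_integrable_mult[OF Q h] by simp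
    \<comment> \<open>In \<open>g w - Q h\<close> the terms \<open>Q f w\<close> cancel, and
      \<open>Q g = Q u + Q^2 f\<close>. What remains is the density of \<open>u * \<phi>\<close>,
      whose boundary values vanish.\<close>
    also have "\<dots> = (LINT x|?M. (- (Q x * u x) - Q x * Q x * f x) * \<phi> x + u x * w x)"
      by (intro Bochner_Integration.integral_cong) (auto simp: h_def g_def algebra_simps)
    also have "\<dots> = 0"
    proof -
      have d: "has_ac_derivative (\<lambda>x. u x * \<phi> x) (\<lambda>x. (- (Q x * u x) - Q x * Q x * f x) * \<phi> x + u x * w x) a b"
        by (rule has_ac_derivative_mult[OF u ac])
      show ?thesis
        using has_ac_derivativeD(2)[OF d, of b] ab z0 by (simp add: integral_Ioo[OF has_ac_derivativeD(1)[OF d]])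
    qed
    finally show ?thesis .
  qed
  have "L2_regular ?J (schroedinger ?J q f)"
    unfolding L2_regular_def square_integrable_on_iff_L2
    by (rule exI[of _ "\<lambda>x. 0"]) (simp add: zero L2_const set_lebesgue_integral_def)
  then have "f \<in> schroedinger_domain ?J q" using fW by (simp add: schroedinger_domain_def)
  moreover have "f x \<noteq> 0" if "x \<in> closure ?J" for x
    using c[of x] that ab by (simp add: f_def z_def)
  ultimately show ?thesis unfolding admissible_def using zero by blast
qed

end
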